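(* Let $\widetilde L$ be an extension of the minimal operator $L_0$ generated by the differential-operator expression $l(\cdot)$ in the weighted Hilbert space $L^2_\alpha$. Then $\widetilde L$ is normal in $L^2_\alpha$ if and only if the extension $\widetilde J=\mathcal F^{\alpha}_{\beta}\,\widetilde L\,\mathcal F^{\beta}_{\alpha}$ of the minimal operator $J_0$ generated by the differential-operator expression $j(\cdot)$ in the weighted Hilbert space $L^2_\beta$ is normal. Moreover, the spectra of $\widetilde L$ and $\widetilde J$ are equal: $$\sigma(\widetilde L)=\sigma(\widetilde J).$$
   Context: $H$ is a separable (complex) Hilbert space. $\alpha,\beta:[0,1]\to[0,\infty)$ are of class $C^2$ on $[0,1]$ and their zero sets have Lebesgue measure $0$. For $\omega\in\{\alpha,\beta\}$, $L^2_\omega=L^2_\omega(H,(0,1))$ is the weighted Hilbert space of $H$-valued functions on $(0,1)$ with inner product $\int_0^1\langle u(t),v(t)\rangle_H\,\omega(t)\,dt$. Assumptions on $A(\cdot)$: for each $t\in[0,1]$, $A(t)$ is a densely defined closed operator in $H$ with domain $D(A)$ independent of $t$ and dense in $H$; $A(t)=A_r(t)+iA_i(t)$ with $A_r(t)=A_r^*(t)$, $A_i(t)=A_i^*(t)$, $A_r(t)A_i(t)=A_i(t)A_r(t)$; for every $f\in D(A)$ the functions $A_r(t)f$, $A_i(t)f$ are strongly continuously differentiable in $H$ on $[0,1]$; $A_r(t)\ge\frac{\alpha'(t)}{2\alpha(t)}I$ for a.e. $t$; and $A_r(t)=\frac{\alpha'(t)}{2\alpha(t)}I+C$ for a.e.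 $t\in(0,1)$, where $C:D(A)\subset H\to H$ is a positive (self-adjoint) operator independent of $t$. The operator $\mathcal F^\beta_\alpha:L^2_\beta\to L^2_\alpha$, $(\mathcal F^\beta_\alpha u)(t)=\sqrt{\beta(t)/\alpha(t)}\,u(t)$, is unitary, with inverse $\mathcal F^\alpha_\beta:L^2_\alpha\to L^2_\beta$, $(\mathcal F^\alpha_\beta u)(t)=\sqrt{\alpha(t)/\beta(t)}\,u(t)$. In $L^2_\alpha$ consider $l(u)=u'(t)+A(t)u(t)$, and in $L^2_\beta$ consider $j(u)=\mathcal F^\alpha_\beta\, l(\mathcal F^\beta_\alpha u)=u'(t)+\left(\frac{\beta'(t)}{2\beta(t)}I+C\right)u(t)+iA_i(t)u(t)$. Let $D_0'$ be the set of finite sums $\sum_k\varphi_k(t)f_k$ with $\varphi_k\in C_0^\infty(0,1)$, $f_k\in D(A)$. The minimal operator $L_0$ (resp. $J_0$) is the closure in $L^2_\alpha$ (resp. $L^2_\beta$) of $l$ (resp. $j$) on $D_0'$. With $l^+$, $j^+$ the formally adjoint expressions in $L^2_\alpha$, $L^2_\beta$ and $L_0^+$, $J_0^+$ the corresponding minimal operators, the maximal operators are $L=(L_0^+)^*$ and $J=(J_0^+)^*$. These operators satisfy $J_0=\mathcal F^\alpha_\beta L_0\mathcal F^\beta_\alpha$ and $J=\mathcal F^\alpha_\beta L\mathcal F^\beta_\alpha$. A densely defined closed operator $N$ is normal if $D(N)=D(N^* )$ and $\|Nu\|=\|N^*u\|$ for $u\in D(N)$. *)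

theory Defs
  imports "HOL-Analysis.Analysis"
begin

section \<open>Separable complex Hilbert spaces\<close>

text \<open>The real structure is the library's, so that Bochner integration and derivatives of
  vector-valued functions apply; \<open>second_countable_topology\<close> expresses separability.
  Complex inner products are linear in the first argument.\<close>

class separable_chilbert = real_inner + banach + second_countable_topology +
  fixes scaleC :: "complex \<Rightarrow> 'a \<Rightarrow> 'a"  (infixr "*\<^sub>C" 75)
    and cinner :: "'a \<Rightarrow> 'a \<Rightarrow> complex"
  assumes scaleC_add_right: "c *\<^sub>C (x + y) = c *\<^sub>C x + c *\<^sub>C y"
    and scaleC_add_left: "(c + d) *\<^sub>C x = c *\<^sub>C x + d *\<^sub>C x"
    and scaleC_scaleC: "c *\<^sub>C d *\<^sub>C x = (c * d) *\<^sub>C x"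
    and scaleC_of_real: "complex_of_real r *\<^sub>C x = r *\<^sub>R x"
    and cinner_add_left: "cinner (x + y) z = cinner x z + cinner y z"
    and cinner_scaleC_left: "cinner (c *\<^sub>C x) y = c * cinner x y"
    and cinner_commute: "cinner x y = cnj (cinner y x)"
    and Re_cinner: "Re (cinner x y) = inner x y"

instantiation complex :: separable_chilbert
begin

definition scaleC_complex :: "complex \<Rightarrow> complex \<Rightarrow> complex"
  where "scaleC_complex c x = c * x"

definition cinner_complex :: "complex \<Rightarrow> complex \<Rightarrow> complex"
  where "cinner_complex x y = x * cnj y"

instance
  by standard
    (simp_all add: scaleC_complex_def cinner_complex_def inner_complex_def algebra_simps
      scaleR_conv_of_real)

end

text \<open>The spaces \<open>L\<^sup>2\<^sub>\<omega>\<close> depend on the weight, so they cannot be types. Hilbert spaces are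
  therefore handled as carriers with operations, and \<open>H\<close> itself is turned into such a record to
  let the operator-theoretic notions below serve for both.\<close>

record 'v hilb =
  hcarrier :: "'v set"
  hadd :: "'v \<Rightarrow> 'v \<Rightarrow> 'v"
  hscale :: "complex \<Rightarrow> 'v \<Rightarrow> 'v"
  hinner :: "'v \<Rightarrow> 'v \<Rightarrow> complex"

definition hdiff :: "'v hilb \<Rightarrow> 'v \<Rightarrow> 'v \<Rightarrow> 'v"
  where "hdiff K x y = hadd K x (hscale K (-1) y)"

definition hnorm :: "'v hilb \<Rightarrow> 'v \<Rightarrow> real"
  where "hnorm K x = sqrt (Re (hinner K x x))"

definition hconverges :: "'v hilb \<Rightarrow> (nat \<Rightarrow> 'v) \<Rightarrow> 'v \<Rightarrow> bool"
  where "hconverges K X x \<longleftrightarrow> (\<lambda>n. hnorm K (hdiff K (X n) x)) \<longlonglongrightarrow> 0"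

definition whole_space :: "('h::separable_chilbert) hilb"
  where "whole_space = \<lparr>hcarrier = UNIV, hadd = (+), hscale = (*\<^sub>C), hinner = cinner\<rparr>"

lemma hnorm_whole_space: "hnorm whole_space x = norm x"
  by (simp add: hnorm_def whole_space_def Re_cinner norm_eq_sqrt_inner)


section \<open>Unbounded operators, represented by their graphs\<close>

type_synonym 'v operator = "('v \<times> 'v) set"

definition op_apply :: "'v operator \<Rightarrow> 'v \<Rightarrow> 'v"
  where "op_apply T x = (THE y. (x, y) \<in> T)"

definition linear_op :: "'v hilb \<Rightarrow> 'v operator \<Rightarrow> bool"
  where "linear_op K T \<longleftrightarrow>
    T \<subseteq> hcarrier K \<times> hcarrier K \<and> T \<noteq> {} \<and> single_valued T \<and>
    (\<forall>x y x' y'. (x, y) \<in> T \<longrightarrow> (x', y') \<in> T \<longrightarrow> (hadd K x x', hadd K y y') \<in> T) \<and>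
    (\<forall>c x y. (x, y) \<in> T \<longrightarrow> (hscale K c x, hscale K c y) \<in> T)"

definition scalar_op :: "'v hilb \<Rightarrow> complex \<Rightarrow> 'v operator"
  where "scalar_op K c = {(x, hscale K c x) | x. x \<in> hcarrier K}"

definition op_add :: "'v hilb \<Rightarrow> 'v operator \<Rightarrow> 'v operator \<Rightarrow> 'v operator"
  where "op_add K S T = {(x, hadd K y z) | x y z. (x, y) \<in> S \<and> (x, z) \<in> T}"

definition op_scale :: "'v hilb \<Rightarrow> complex \<Rightarrow> 'v operator \<Rightarrow> 'v operator"
  where "op_scale K c T = {(x, hscale K c y) | x y. (x, y) \<in> T}"

definition densely_defined :: "'v hilb \<Rightarrow> 'v operator \<Rightarrow> bool"
  where "densely_defined K T \<longleftrightarrow>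
    (\<forall>x\<in>hcarrier K. \<exists>X. (\<forall>n. X n \<in> Domain T) \<and> hconverges K X x)"

definition op_closure :: "'v hilb \<Rightarrow> 'v operator \<Rightarrow> 'v operator"
  where "op_closure K T = {(x, y). x \<in> hcarrier K \<and> y \<in> hcarrier K \<and>
    (\<exists>X Y. (\<forall>n. (X n, Y n) \<in> T) \<and> hconverges K X x \<and> hconverges K Y y)}"

definition closed_op :: "'v hilb \<Rightarrow> 'v operator \<Rightarrow> bool"
  where "closed_op K T \<longleftrightarrow> op_closure K T \<subseteq> T"

definition adjoint_op :: "'v hilb \<Rightarrow> 'v operator \<Rightarrow> 'v operator"
  where "adjoint_op K T = {(v, w). v \<in> hcarrier K \<and> w \<in> hcarrier K \<and>
    (\<forall>x y. (x, y) \<in> T \<longrightarrow> hinner K y v = hinner K x w)}"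

definition self_adjoint_op :: "'v hilb \<Rightarrow> 'v operator \<Rightarrow> bool"
  where "self_adjoint_op K T \<longleftrightarrow> linear_op K T \<and> densely_defined K T \<and> adjoint_op K T = T"

text \<open>\<open>T \<ge> c I\<close> for symmetric \<open>T\<close>; the form \<open>\<langle>T x, x\<rangle>\<close> is then real.\<close>

definition op_bounded_below :: "'v hilb \<Rightarrow> real \<Rightarrow> 'v operator \<Rightarrow> bool"
  where "op_bounded_below K c T \<longleftrightarrow>
    (\<forall>x y. (x, y) \<in> T \<longrightarrow> c * (hnorm K x)\<^sup>2 \<le> Re (hinner K y x))"

text \<open>\<open>S T x = T S x\<close> for every \<open>x\<close> at which both products are defined. Equality of the
  products with their natural domains, as well as commutation of the spectral measures,
  imply this.\<close>

definition ops_commute :: "'v operator \<Rightarrow> 'v operator \<Rightarrow> bool"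
  where "ops_commute S T \<longleftrightarrow> (\<forall>x y z. (x, y) \<in> T O S \<longrightarrow> (x, z) \<in> S O T \<longrightarrow> y = z)"

definition normal_op :: "'v hilb \<Rightarrow> 'v operator \<Rightarrow> bool"
  where "normal_op K N \<longleftrightarrow>
    linear_op K N \<and> densely_defined K N \<and> closed_op K N \<and>
    Domain N = Domain (adjoint_op K N) \<and>
    (\<forall>u v w. (u, v) \<in> N \<longrightarrow> (u, w) \<in> adjoint_op K N \<longrightarrow> hnorm K v = hnorm K w)"

definition op_spectrum :: "'v hilb \<Rightarrow> 'v operator \<Rightarrow> complex set"
  where "op_spectrum K T = - {\<mu>.
    (let S = op_add K T (scalar_op K (- \<mu>)) in
      single_valued (S\<inverse>) \<and> Range S = hcarrier K \<and>
      (\<exists>M. \<forall>x y. (x, y) \<in> S \<longrightarrow> hnorm K x \<le> M * hnorm K y))}"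

definition op_extension :: "'v hilb \<Rightarrow> 'v operator \<Rightarrow> 'v operator \<Rightarrow> bool"
  where "op_extension K T\<^sub>0 T \<longleftrightarrow> linear_op K T \<and> T\<^sub>0 \<subseteq> T"


section \<open>Weighted spaces of vector-valued functions on the unit interval\<close>

abbreviation unit_lebesgue :: "real measure"
  where "unit_lebesgue \<equiv> lebesgue_on {0<..<1}"

definition ae_class :: "(real \<Rightarrow> 'h::separable_chilbert) \<Rightarrow> (real \<Rightarrow> 'h) set"
  where "ae_class u = {v \<in> borel_measurable unit_lebesgue. AE t in unit_lebesgue. v t = u t}"

definition ae_rep :: "(real \<Rightarrow> 'h::separable_chilbert) set \<Rightarrow> real \<Rightarrow> 'h"
  where "ae_rep U = (SOME u. u \<in> U)"

definition weighted_L2 :: "(real \<Rightarrow> real) \<Rightarrow> (real \<Rightarrow> 'h::separable_chilbert) set hilb"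
  where "weighted_L2 \<omega> =
    \<lparr>hcarrier = {ae_class u | u. u \<in> borel_measurable unit_lebesgue \<and>
                   integrable unit_lebesgue (\<lambda>t. (norm (u t))\<^sup>2 * \<omega> t)},
     hadd = (\<lambda>U V. ae_class (\<lambda>t. ae_rep U t + ae_rep V t)),
     hscale = (\<lambda>c U. ae_class (\<lambda>t. c *\<^sub>C ae_rep U t)),
     hinner = (\<lambda>U V. LINT t|unit_lebesgue.
                 cinner (ae_rep U t) (ae_rep V t) * complex_of_real (\<omega> t))\<rparr>"

text \<open>The operator \<open>\<F>\<close> with lower index \<open>\<omega>\<^sub>2\<close> and upper index \<open>\<omega>\<^sub>1\<close>, mapping
  \<open>weighted_L2 \<omega>\<^sub>1\<close> to \<open>weighted_L2 \<omega>\<^sub>2\<close>.\<close>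

definition weight_map :: "(real \<Rightarrow> real) \<Rightarrow> (real \<Rightarrow> real) \<Rightarrow>
    (real \<Rightarrow> 'h::separable_chilbert) set \<Rightarrow> (real \<Rightarrow> 'h) set"
  where "weight_map \<omega>\<^sub>1 \<omega>\<^sub>2 U = ae_class (\<lambda>t. sqrt (\<omega>\<^sub>1 t / \<omega>\<^sub>2 t) *\<^sub>R ae_rep U t)"

text \<open>The product of \<open>weight_map \<alpha> \<beta>\<close>, \<open>T\<close> and \<open>weight_map \<beta> \<alpha>\<close>, on its natural domain.\<close>

definition transported_op :: "(real \<Rightarrow> real) \<Rightarrow> (real \<Rightarrow> real) \<Rightarrow>
    (real \<Rightarrow> 'h::separable_chilbert) set operator \<Rightarrow> (real \<Rightarrow> 'h) set operator"
  where "transported_op \<alpha> \<beta> T =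
    {(U, weight_map \<alpha> \<beta> V) | U V. U \<in> hcarrier (weighted_L2 \<beta>) \<and> (weight_map \<beta> \<alpha> U, V) \<in> T}"


section \<open>Differential-operator expressions and minimal operators\<close>

definition C1_on_unit :: "(real \<Rightarrow> 'b::real_normed_vector) \<Rightarrow> bool"
  where "C1_on_unit u \<longleftrightarrow> (\<exists>u'. continuous_on {0..1} u' \<and>
    (\<forall>t\<in>{0..1}. (u has_vector_derivative u' t) (at t within {0..1})))"

definition C2_on_unit :: "(real \<Rightarrow> 'b::real_normed_vector) \<Rightarrow> bool"
  where "C2_on_unit u \<longleftrightarrow> (\<exists>u'. C1_on_unit u' \<and>
    (\<forall>t\<in>{0..1}. (u has_vector_derivative u' t) (at t within {0..1})))"

definition test_function :: "(real \<Rightarrow> complex) \<Rightarrow> bool"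
  where "test_function \<phi> \<longleftrightarrow>
    (\<exists>D. D 0 = \<phi> \<and> (\<forall>n t. (D n has_vector_derivative D (Suc n) t) (at t))) \<and>
    (\<exists>a b. 0 < a \<and> b < 1 \<and> (\<forall>t. t \<notin> {a..b} \<longrightarrow> \<phi> t = 0))"

definition elementary_functions :: "'h::separable_chilbert set \<Rightarrow> (real \<Rightarrow> 'h) set"
  where "elementary_functions D = {\<lambda>t. \<Sum>k<n. \<phi> k t *\<^sub>C f k | (n::nat) \<phi> f.
    \<forall>k<n. test_function (\<phi> k) \<and> f k \<in> D}"

text \<open>The expression \<open>u' + B(t) u\<close>.\<close>

definition diff_expr :: "(real \<Rightarrow> 'h::separable_chilbert operator) \<Rightarrow> (real \<Rightarrow> 'h) \<Rightarrow> real \<Rightarrow> 'h"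
  where "diff_expr B u = (\<lambda>t. vector_derivative u (at t) + op_apply (B t) (u t))"

definition minimal_op :: "(real \<Rightarrow> real) \<Rightarrow> 'h::separable_chilbert set \<Rightarrow>
    (real \<Rightarrow> 'h operator) \<Rightarrow> (real \<Rightarrow> 'h) set operator"
  where "minimal_op \<omega> D B =
    op_closure (weighted_L2 \<omega>) {(ae_class u, ae_class (diff_expr B u)) | u. u \<in> elementary_functions D}"

definition log_drift :: "(real \<Rightarrow> real) \<Rightarrow> real \<Rightarrow> real"
  where "log_drift \<omega> t = deriv \<omega> t / (2 * \<omega> t)"

text \<open>\<open>\<omega>'(t) / (2 \<omega>(t)) I + C\<close>\<close>

definition drift_op :: "(real \<Rightarrow> real) \<Rightarrow> 'h::separable_chilbert operator \<Rightarrow> real \<Rightarrow> 'h operator"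
  where "drift_op \<omega> C t =
    op_add whole_space (scalar_op whole_space (complex_of_real (log_drift \<omega> t))) C"

end

theory Submission
  imports Defs
begin

text \<open>The map \<open>weight_map \<alpha> \<beta>\<close> is unitary, and the transported operator is the unitary image of the given
  one. Adjoints, closedness, norms and resolvents are defined from the Hilbert space structure alone,
  so normality and the spectrum are carried over (\<open>normal_op_image_iff\<close>, \<open>op_spectrum_image\<close>).

  What remains is that the transported operator extends \<open>J\<^sub>0\<close>, that is, that the inverse unitary,
  multiplication by \<open>s = \<surd>(\<beta> / \<alpha>)\<close>, carries \<open>J\<^sub>0\<close> into \<open>L\<^sub>0\<close>. Formally this is the product rule: the
  logarithmic derivative of \<open>s\<close> is \<open>\<beta>' / (2 \<beta>) - \<alpha>' / (2 \<alpha>)\<close>, which is the difference of the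
  coefficients of the two differential expressions. However, \<open>s\<close> times an elementary function is not
  elementary; if \<open>\<beta>\<close> has zeros it need not even be differentiable. It lies in the domain of the closure
  \<open>L\<^sub>0\<close> for the following reasons.

  First, \<open>\<alpha>\<close> has no zeros in \<open>(0,1)\<close>: for a nonzero vector \<open>f\<close> of the domain, \<open>A\<^sub>r(t) f - C f\<close> is
  continuous in \<open>t\<close> and equals \<open>\<alpha>'(t) / (2 \<alpha>(t)) f\<close> almost everywhere, so \<open>\<alpha>\<close> solves a linear
  differential equation with continuous coefficient (\<open>continuous_log_drift_imp_pos\<close>). Second,
  \<open>\<beta>'\<^sup>2 \<le> N \<beta>\<close> on compact subintervals, as \<open>\<beta>\<close> is nonnegative and of class \<open>C\<^sup>2\<close>
  (\<open>nonneg_C2_derivative_bound\<close>). Hence \<open>s\<close> is locally Lipschitz, and there are polynomials \<open>P\<^sub>n\<close>,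
  bounded together with their derivatives on the support in question, such that \<open>P\<^sub>n\<close> tends to \<open>s\<close> and
  \<open>P\<^sub>n'\<close> to \<open>s'\<close> almost everywhere (\<open>sqrt_quotient_polynomial_approx\<close>). Products of polynomials with
  elementary functions are elementary, and dominated convergence in both components of the graph
  gives the claim (\<open>weight_map_elementary\<close>).\<close>


section \<open>Unitary equivalence of operators given by graphs\<close>

text \<open>The carriers are arbitrary sets with operations, so closure under the operations has to be
  demanded; it passes from \<open>K\<close> to \<open>K'\<close> along the bijection, and with it the whole notion is
  symmetric.\<close>
locale hilb_unitary =
  fixes K :: "'a hilb" and K' :: "'b hilb" and F :: "'a \<Rightarrow> 'b"
  assumes bij: "bij_betw F (hcarrier K) (hcarrier K')"
    and hadd_closed: "\<lbrakk>x \<in> hcarrier K; y \<in> hcarrier K\<rbrakk> \<Longrightarrow> hadd K x y \<in> hcarrier K"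
    and hscale_closed: "x \<in> hcarrier K \<Longrightarrow> hscale K c x \<in> hcarrier K"
    and map_hadd: "\<lbrakk>x \<in> hcarrier K; y \<in> hcarrier K\<rbrakk> \<Longrightarrow> F (hadd K x y) = hadd K' (F x) (F y)"
    and map_hscale: "x \<in> hcarrier K \<Longrightarrow> F (hscale K c x) = hscale K' c (F x)"
    and map_hinner: "\<lbrakk>x \<in> hcarrier K; y \<in> hcarrier K\<rbrakk> \<Longrightarrow> hinner K' (F x) (F y) = hinner K x y"
begin

lemma map_carrier: "x \<in> hcarrier K \<Longrightarrow> F x \<in> hcarrier K'"
  using bij by (auto simp: bij_betw_def)

lemma map_eq_iff: "\<lbrakk>x \<in> hcarrier K; y \<in> hcarrier K\<rbrakk> \<Longrightarrow> F x = F y \<longleftrightarrow> x = y"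
  using bij by (auto simp: bij_betw_def inj_on_def)

lemma map_surj: "y \<in> hcarrier K' \<Longrightarrow> \<exists>x\<in>hcarrier K. y = F x"
  using bij by (auto simp: bij_betw_def)

lemma map_hdiff:
  "\<lbrakk>x \<in> hcarrier K; y \<in> hcarrier K\<rbrakk> \<Longrightarrow> hdiff K' (F x) (F y) = F (hdiff K x y)"
  by (simp add: hdiff_def map_hadd map_hscale hscale_closed)

lemma map_hnorm: "x \<in> hcarrier K \<Longrightarrow> hnorm K' (F x) = hnorm K x"
  by (simp add: hnorm_def map_hinner)

lemma hdiff_closed: "\<lbrakk>x \<in> hcarrier K; y \<in> hcarrier K\<rbrakk> \<Longrightarrow> hdiff K x y \<in> hcarrier K"
  by (simp add: hdiff_def hadd_closed hscale_closed)

lemma map_hconverges: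
  assumes "\<And>n. X n \<in> hcarrier K" "x \<in> hcarrier K"
  shows "hconverges K' (\<lambda>n. F (X n)) (F x) \<longleftrightarrow> hconverges K X x"
  using assms by (simp add: hconverges_def map_hdiff map_hnorm hdiff_closed)

lemma inverse_unitary: "hilb_unitary K' K (inv_into (hcarrier K) F)"
proof
  let ?G = "inv_into (hcarrier K) F"
  have G: "?G (F x) = x" if "x \<in> hcarrier K" for x
    using bij that by (simp add: bij_betw_inv_into_left)
  show "bij_betw ?G (hcarrier K') (hcarrier K)"
    using bij by (rule bij_betw_inv_into)
  fix c x y
  assume "x \<in> hcarrier K'"
  then obtain a where a: "a \<in> hcarrier K" "x = F a" using map_surj by blast
  show "hscale K' c x \<in> hcarrier K'" "?G (hscale K' c x) = hscale K c (?G x)"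
    using a by (simp_all add: map_hscale[symmetric] map_carrier hscale_closed G)
  assume "y \<in> hcarrier K'"
  then obtain b where b: "b \<in> hcarrier K" "y = F b" using map_surj by blast
  show "hadd K' x y \<in> hcarrier K'" "?G (hadd K' x y) = hadd K (?G x) (?G y)"
      "hinner K (?G x) (?G y) = hinner K' x y"
    using a b by (simp_all add: map_hadd[symmetric] map_carrier hadd_closed G map_hinner)
qed

text \<open>The graph of \<open>F T F\<^sup>-\<^sup>1\<close>, written without an inverse function.\<close>
definition op_image :: "'a operator \<Rightarrow> 'b operator"
  where "op_image T = map_prod F F ` T"

lemma op_image_iff:
  assumes "T \<subseteq> hcarrier K \<times> hcarrier K" "x \<in> hcarrier K" "y \<in> hcarrier K"
  shows "(F x, F y) \<in> op_image T \<longleftrightarrow> (x, y) \<in> T"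
proof
  assume "(F x, F y) \<in> op_image T"
  then obtain a b where "(a, b) \<in> T" "F x = F a" "F y = F b" by (auto simp: op_image_def)
  with assms show "(x, y) \<in> T" by (metis SigmaD1 SigmaD2 map_eq_iff subsetD)
qed (force simp: op_image_def)

lemma op_image_cases:
  assumes "(x', y') \<in> op_image T" "T \<subseteq> hcarrier K \<times> hcarrier K"
  obtains x y where "x' = F x" "y' = F y" "(x, y) \<in> T" "x \<in> hcarrier K" "y \<in> hcarrier K"
  using assms by (auto simp: op_image_def)

lemma Domain_op_image: "Domain (op_image T) = F ` Domain T"
  by (force simp: op_image_def)

lemma Range_op_image: "Range (op_image T) = F ` Range T"
  by (force simp: op_image_def)

lemma linear_op_image:
  assumes T: "linear_op K T"
  shows "linear_op K' (op_image T)"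
  unfolding linear_op_def
proof (intro conjI allI impI)
  have sub: "T \<subseteq> hcarrier K \<times> hcarrier K" using T by (simp add: linear_op_def)
  show "op_image T \<subseteq> hcarrier K' \<times> hcarrier K'"
    using sub map_carrier by (auto simp: op_image_def)
  show "op_image T \<noteq> {}" using T by (simp add: linear_op_def op_image_def)
  show "single_valued (op_image T)"
  proof (rule single_valuedI)
    fix x y z assume "(x, y) \<in> op_image T" "(x, z) \<in> op_image T"
    then show "y = z"
      using T sub by (elim op_image_cases[OF _ sub])
        (metis linear_op_def map_eq_iff single_valuedD)
  qed
  fix x y x' y'
  assume 1: "(x, y) \<in> op_image T"
  show "(hscale K' c x, hscale K' c y) \<in> op_image T" for c
    using 1 T by (elim op_image_cases[OF _ sub])
      (simp add: map_hscale[symmetric] op_image_iff[OF sub] hscale_closed linear_op_def)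
  assume 2: "(x', y') \<in> op_image T"
  from 1 obtain a b where ab: "x = F a" "y = F b" "(a, b) \<in> T" "a \<in> hcarrier K" "b \<in> hcarrier K"
    by (rule op_image_cases[OF _ sub])
  from 2 obtain c d where cd: "x' = F c" "y' = F d" "(c, d) \<in> T" "c \<in> hcarrier K" "d \<in> hcarrier K"
    by (rule op_image_cases[OF _ sub])
  from T ab cd have "(hadd K a c, hadd K b d) \<in> T" by (simp add: linear_op_def)
  with ab cd show "(hadd K' x x', hadd K' y y') \<in> op_image T"
    by (simp add: map_hadd[symmetric] op_image_iff[OF sub] hadd_closed)
qed

lemma op_closure_image:
  assumes sub: "T \<subseteq> hcarrier K \<times> hcarrier K"
  shows "op_closure K' (op_image T) = op_image (op_closure K T)"
proof (intro set_eqI iffI)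
  fix p assume "p \<in> op_closure K' (op_image T)"
  then obtain x' y' X' Y' where p: "p = (x', y')" "x' \<in> hcarrier K'" "y' \<in> hcarrier K'"
    and XY: "\<And>n. (X' n, Y' n) \<in> op_image T" "hconverges K' X' x'" "hconverges K' Y' y'"
    by (auto simp: op_closure_def)
  from XY(1) have "\<forall>n. \<exists>q\<in>T. (X' n, Y' n) = map_prod F F q"
    unfolding op_image_def by (simp add: image_iff)
  then obtain Q where Q: "\<And>n. Q n \<in> T" "\<And>n. (X' n, Y' n) = map_prod F F (Q n)"
    by metis
  define X Y where "X = fst \<circ> Q" and "Y = snd \<circ> Q"
  have T: "(X n, Y n) \<in> T" and F: "X' n = F (X n)" "Y' n = F (Y n)" for n
    using Q[of n] by (auto simp: X_def Y_def prod_eq_iff)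
  have c: "X n \<in> hcarrier K" "Y n \<in> hcarrier K" for n using T sub by auto
  obtain x y where xy: "x \<in> hcarrier K" "y \<in> hcarrier K" "x' = F x" "y' = F y"
    using p map_surj by metis
  have "X' = (\<lambda>n. F (X n))" "Y' = (\<lambda>n. F (Y n))" using F by auto
  with XY xy c have "hconverges K X x" "hconverges K Y y" by (simp_all add: map_hconverges)
  with T xy have "(x, y) \<in> op_closure K T" by (auto simp: op_closure_def)
  with p xy show "p \<in> op_image (op_closure K T)" by (force simp: op_image_def)
next
  fix p assume "p \<in> op_image (op_closure K T)"
  then obtain x y X Y where p: "p = (F x, F y)" "x \<in> hcarrier K" "y \<in> hcarrier K"
    and XY: "\<And>n. (X n, Y n) \<in> T" "hconverges K X x" "hconverges K Y y"
    by (auto simp: op_closure_def op_image_def)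
  have "X n \<in> hcarrier K" "Y n \<in> hcarrier K" for n using XY sub by auto
  with p XY sub have "(F (X n), F (Y n)) \<in> op_image T" "hconverges K' (\<lambda>n. F (X n)) (F x)"
      "hconverges K' (\<lambda>n. F (Y n)) (F y)" for n
    by (simp_all add: map_hconverges op_image_iff)
  with p show "p \<in> op_closure K' (op_image T)"
    unfolding op_closure_def mem_Collect_eq p(1) prod.case
    by (intro conjI exI[where x = "\<lambda>n. F (X n)"] exI[where x = "\<lambda>n. F (Y n)"])
      (simp_all add: map_carrier)
qed

lemma adjoint_op_image:
  assumes sub: "T \<subseteq> hcarrier K \<times> hcarrier K"
  shows "adjoint_op K' (op_image T) = op_image (adjoint_op K T)"
proof -
  have adj: "(F v, F w) \<in> adjoint_op K' (op_image T) \<longleftrightarrow> (v, w) \<in> adjoint_op K T"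
    if vw: "v \<in> hcarrier K" "w \<in> hcarrier K" for v w
  proof -
    have "(\<forall>x y. (x, y) \<in> op_image T \<longrightarrow> hinner K' y (F v) = hinner K' x (F w)) \<longleftrightarrow>
        (\<forall>(x, y)\<in>T. hinner K' (F y) (F v) = hinner K' (F x) (F w))"
      by (auto simp: op_image_def)
    also have "\<dots> \<longleftrightarrow> (\<forall>(x, y)\<in>T. hinner K y v = hinner K x w)"
      using sub vw by (intro ball_cong) (auto simp: map_hinner)
    finally show ?thesis using vw by (auto simp: adjoint_op_def map_carrier)
  qed
  have sub': "adjoint_op K T \<subseteq> hcarrier K \<times> hcarrier K" by (auto simp: adjoint_op_def)
  show ?thesis
  proof (intro set_eqI iffI)
    fix p assume p: "p \<in> adjoint_op K' (op_image T)"
    then have "p \<in> hcarrier K' \<times> hcarrier K'" by (auto simp: adjoint_op_def)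
    then obtain v w where "p = (F v, F w)" "v \<in> hcarrier K" "w \<in> hcarrier K"
      using map_surj by blast
    with p show "p \<in> op_image (adjoint_op K T)" by (simp add: adj op_image_iff[OF sub'])
  next
    fix p assume "p \<in> op_image (adjoint_op K T)"
    with sub' show "p \<in> adjoint_op K' (op_image T)"
      by (cases p) (auto elim!: op_image_cases simp: adj)
  qed
qed

lemma densely_defined_image:
  assumes sub: "T \<subseteq> hcarrier K \<times> hcarrier K" and dense: "densely_defined K T"
  shows "densely_defined K' (op_image T)"
  unfolding densely_defined_def
proof
  fix x' assume "x' \<in> hcarrier K'"
  then obtain x where x: "x \<in> hcarrier K" "x' = F x" using map_surj by blast
  with dense obtain X where X: "\<And>n. X n \<in> Domain T" "hconverges K X x"
    unfolding densely_defined_def by blast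
  from X sub have "X n \<in> hcarrier K" for n by blast
  with x X have "hconverges K' (\<lambda>n. F (X n)) x'" by (simp add: map_hconverges)
  moreover have "\<forall>n. F (X n) \<in> Domain (op_image T)" using X by (simp add: Domain_op_image)
  ultimately show "\<exists>X. (\<forall>n. X n \<in> Domain (op_image T)) \<and> hconverges K' X x'"
    by (intro exI[of _ "\<lambda>n. F (X n)"] conjI)
qed

lemma normal_op_image:
  assumes T: "normal_op K T"
  shows "normal_op K' (op_image T)"
proof -
  have sub: "T \<subseteq> hcarrier K \<times> hcarrier K" using T by (simp add: normal_op_def linear_op_def)
  have sub': "adjoint_op K T \<subseteq> hcarrier K \<times> hcarrier K" by (auto simp: adjoint_op_def)
  have "closed_op K' (op_image T)"
    using T unfolding normal_op_def closed_op_def op_closure_image[OF sub]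
    by (auto simp: op_image_def)
  moreover have "hnorm K' v = hnorm K' w"
    if v: "(u, v) \<in> op_image T" and w: "(u, w) \<in> op_image (adjoint_op K T)" for u v w
  proof -
    obtain a b where "u = F a" "v = F b" "(a, b) \<in> T" "a \<in> hcarrier K" "b \<in> hcarrier K"
      using v by (rule op_image_cases[OF _ sub])
    moreover obtain a' c where "u = F a'" "w = F c" "(a', c) \<in> adjoint_op K T"
        "a' \<in> hcarrier K" "c \<in> hcarrier K"
      using w by (rule op_image_cases[OF _ sub'])
    moreover from calculation have "a = a'" by (simp add: map_eq_iff)
    ultimately show ?thesis using T by (simp add: normal_op_def map_hnorm)
  qed
  ultimately show ?thesis
    using T sub
    by (auto simp: normal_op_def linear_op_image densely_defined_image adjoint_op_image
        Domain_op_image)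
qed

text \<open>The image of \<open>T - \<mu>\<close> is the image of \<open>T\<close> minus \<open>\<mu>\<close>, and injectivity, surjectivity and
  boundedness of the inverse are each unaffected by passing to the image.\<close>
lemma op_spectrum_image:
  assumes sub: "T \<subseteq> hcarrier K \<times> hcarrier K"
  shows "op_spectrum K' (op_image T) = op_spectrum K T"
proof -
  define S where "S \<mu> = op_add K T (scalar_op K (- \<mu>))" for \<mu>
  have S: "S \<mu> = (\<lambda>(x, y). (x, hadd K y (hscale K (- \<mu>) x))) ` T" for \<mu>
    using sub by (force simp: S_def op_add_def scalar_op_def)
  have Ssub: "S \<mu> \<subseteq> hcarrier K \<times> hcarrier K" for \<mu>
    using sub by (auto simp: S hadd_closed hscale_closed)
  have "op_add K' (op_image T) (scalar_op K' (- \<mu>)) =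
      (\<lambda>(x, y). (x, hadd K' y (hscale K' (- \<mu>) x))) ` op_image T" for \<mu>
    using sub map_carrier by (force simp: op_add_def scalar_op_def op_image_def)
  also have "\<dots> \<mu> = op_image (S \<mu>)" for \<mu>
    using sub unfolding S op_image_def image_image
    by (intro image_cong) (auto simp: map_hadd map_hscale hscale_closed)
  finally have S': "op_add K' (op_image T) (scalar_op K' (- \<mu>)) = op_image (S \<mu>)" for \<mu> .
  have inj: "single_valued ((op_image (S \<mu>))\<inverse>) \<longleftrightarrow> single_valued ((S \<mu>)\<inverse>)" for \<mu>
  proof
    assume *: "single_valued ((op_image (S \<mu>))\<inverse>)"
    show "single_valued ((S \<mu>)\<inverse>)"
    proof (rule single_valuedI)
      fix y x z assume "(y, x) \<in> (S \<mu>)\<inverse>" "(y, z) \<in> (S \<mu>)\<inverse>"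
      moreover from this have "x \<in> hcarrier K" "z \<in> hcarrier K" "y \<in> hcarrier K"
        using Ssub by auto
      ultimately have "F x = F z"
        using single_valuedD[OF *, of "F y" "F x" "F z"] by (simp add: op_image_iff[OF Ssub])
      then show "x = z" using \<open>x \<in> _\<close> \<open>z \<in> _\<close> by (simp add: map_eq_iff)
    qed
  next
    assume *: "single_valued ((S \<mu>)\<inverse>)"
    show "single_valued ((op_image (S \<mu>))\<inverse>)"
    proof (rule single_valuedI)
      fix y x z assume "(y, x) \<in> (op_image (S \<mu>))\<inverse>" "(y, z) \<in> (op_image (S \<mu>))\<inverse>"
      then have "(x, y) \<in> op_image (S \<mu>)" "(z, y) \<in> op_image (S \<mu>)" by simp_all
      then obtain a b c d where "x = F a" "y = F b" "(a, b) \<in> S \<mu>" "z = F c" "y = F d" "(c, d) \<in> S \<mu>"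
        unfolding op_image_def by blast
      moreover from this have "b \<in> hcarrier K" "d \<in> hcarrier K" using Ssub[of \<mu>] by auto
      ultimately have "x = F a" "z = F c" "(b, a) \<in> (S \<mu>)\<inverse>" "(b, c) \<in> (S \<mu>)\<inverse>"
        by (simp_all add: map_eq_iff)
      then show "x = z" using single_valuedD[OF *, of b a c] by simp
    qed
  qed
  have range: "F ` Range (S \<mu>) = hcarrier K' \<longleftrightarrow> Range (S \<mu>) = hcarrier K" for \<mu>
  proof -
    have "Range (S \<mu>) \<subseteq> hcarrier K" using Ssub by auto
    then show ?thesis using bij by (metis bij_betw_def inj_on_image_eq_iff order_refl)
  qed
  have bound: "(\<forall>x y. (x, y) \<in> op_image (S \<mu>) \<longrightarrow> hnorm K' x \<le> M * hnorm K' y) \<longleftrightarrow>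
      (\<forall>x y. (x, y) \<in> S \<mu> \<longrightarrow> hnorm K x \<le> M * hnorm K y)" (is "?L \<longleftrightarrow> ?R") for M \<mu>
  proof -
    have "?L \<longleftrightarrow> (\<forall>(x, y)\<in>S \<mu>. hnorm K' (F x) \<le> M * hnorm K' (F y))"
      by (auto simp: op_image_def)
    also have "\<dots> \<longleftrightarrow> (\<forall>(x, y)\<in>S \<mu>. hnorm K x \<le> M * hnorm K y)"
      using Ssub[of \<mu>] by (intro ball_cong) (auto simp: map_hnorm)
    finally show ?thesis by auto
  qed
  show ?thesis
    by (simp add: op_spectrum_def S' S_def[symmetric] Let_def inj Range_op_image range bound)
qed

end

text \<open>The converse is the forward direction for the inverse unitary, which moves the image of \<open>T\<close> back
  to \<open>T\<close>.\<close>
lemma (in hilb_unitary) normal_op_image_iff: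
  assumes T: "T \<subseteq> hcarrier K \<times> hcarrier K"
  shows "normal_op K' (op_image T) \<longleftrightarrow> normal_op K T"
proof
  interpret inv: hilb_unitary K' K "inv_into (hcarrier K) F" by (rule inverse_unitary)
  assume "normal_op K' (op_image T)"
  then have "normal_op K (inv.op_image (op_image T))" by (rule inv.normal_op_image)
  also have "inv.op_image (op_image T) = (\<lambda>x. x) ` T"
    unfolding inv.op_image_def op_image_def image_image
    using T by (intro image_cong) (auto simp: bij_betw_inv_into_left[OF bij])
  finally show "normal_op K T" by simp
qed (rule normal_op_image)

text \<open>A diagonal sequence. The parallelogram inequality suffices in place of the triangle inequality,
  and in a space of square integrable functions it follows by integrating a pointwise bound.\<close>

lemma op_closure_closed:
  assumes quasi_triangle: "\<And>x y z. \<lbrakk>x \<in> hcarrier K; y \<in> hcarrier K; z \<in> hcarrier K\<rbrakk> \<Longrightarrow>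
      (hnorm K (hdiff K x z))\<^sup>2 \<le> 2 * (hnorm K (hdiff K x y))\<^sup>2 + 2 * (hnorm K (hdiff K y z))\<^sup>2"
    and T: "T \<subseteq> hcarrier K \<times> hcarrier K"
  shows "op_closure K (op_closure K T) \<subseteq> op_closure K T"
proof (rule subrelI)
  fix x y assume "(x, y) \<in> op_closure K (op_closure K T)"
  then obtain X Y where xy: "x \<in> hcarrier K" "y \<in> hcarrier K"
    and XY: "\<And>n. (X n, Y n) \<in> op_closure K T" "hconverges K X x" "hconverges K Y y"
    by (auto simp: op_closure_def)
  have "\<exists>a b. (a, b) \<in> T \<and> (hnorm K (hdiff K a (X n)))\<^sup>2 < 1 / Suc n \<and>
      (hnorm K (hdiff K b (Y n)))\<^sup>2 < 1 / Suc n" for n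
  proof -
    obtain A B where AB: "\<And>m. (A m, B m) \<in> T" "hconverges K A (X n)" "hconverges K B (Y n)"
      using XY(1)[of n] by (auto simp: op_closure_def)
    have "(\<lambda>m. (hnorm K (hdiff K (A m) (X n)))\<^sup>2) \<longlonglongrightarrow> 0\<^sup>2"
      "(\<lambda>m. (hnorm K (hdiff K (B m) (Y n)))\<^sup>2) \<longlonglongrightarrow> 0\<^sup>2"
      using AB by (auto intro!: tendsto_power simp: hconverges_def)
    then have "\<forall>\<^sub>F m in sequentially. (hnorm K (hdiff K (A m) (X n)))\<^sup>2 < 1 / Suc n"
      "\<forall>\<^sub>F m in sequentially. (hnorm K (hdiff K (B m) (Y n)))\<^sup>2 < 1 / Suc n"
      by (auto intro!: order_tendstoD(2)[where y = 0])
    then have "\<forall>\<^sub>F m in sequentially. (hnorm K (hdiff K (A m) (X n)))\<^sup>2 < 1 / Suc n \<and>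
      (hnorm K (hdiff K (B m) (Y n)))\<^sup>2 < 1 / Suc n"
      by (rule eventually_conj)
    from eventually_happens[OF this] AB(1) show ?thesis by auto
  qed
  then obtain A B where AB: "\<And>n. (A n, B n) \<in> T"
    "\<And>n. (hnorm K (hdiff K (A n) (X n)))\<^sup>2 < 1 / Suc n"
    "\<And>n. (hnorm K (hdiff K (B n) (Y n)))\<^sup>2 < 1 / Suc n"
    by metis
  have conv: "hconverges K A x"
    if "\<And>n. A n \<in> hcarrier K" "\<And>n. X n \<in> hcarrier K" "x \<in> hcarrier K" "hconverges K X x"
      "\<And>n. (hnorm K (hdiff K (A n) (X n)))\<^sup>2 < 1 / Suc n" for A X x
  proof -
    have "(\<lambda>n. 2 * (1 / Suc n) + 2 * (hnorm K (hdiff K (X n) x))\<^sup>2) \<longlonglongrightarrow> 2 * 0 + 2 * 0\<^sup>2"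
      using that by (intro tendsto_intros LIMSEQ_Suc[OF lim_1_over_n]) (simp add: hconverges_def)
    then have lim: "(\<lambda>n. 2 * (1 / Suc n) + 2 * (hnorm K (hdiff K (X n) x))\<^sup>2) \<longlonglongrightarrow> 0" by simp
    have le: "(hnorm K (hdiff K (A n) x))\<^sup>2 \<le> 2 * (1 / Suc n) + 2 * (hnorm K (hdiff K (X n) x))\<^sup>2"
      for n using quasi_triangle[OF that(1)[of n] that(2)[of n] that(3)] that(5)[of n] by linarith
    have "(\<lambda>n. (hnorm K (hdiff K (A n) x))\<^sup>2) \<longlonglongrightarrow> 0"
      by (rule tendsto_sandwich[OF _ _ tendsto_const lim]) (use le in auto)
    from tendsto_real_sqrt[OF this] show ?thesis
      by (simp add: hconverges_def tendsto_rabs_zero_iff)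
  qed
  have "X n \<in> hcarrier K \<and> Y n \<in> hcarrier K" "A n \<in> hcarrier K \<and> B n \<in> hcarrier K" for n
    using XY(1)[of n] AB(1)[of n] T by (auto simp: op_closure_def)
  then have "hconverges K A x" "hconverges K B y"
    using xy XY AB conv[of A X x] conv[of B Y y] by auto
  with AB xy show "(x, y) \<in> op_closure K T" by (auto simp: op_closure_def)
qed

section \<open>Complex scalars and inner products\<close>

lemma cinner_scaleC_right: "cinner x (c *\<^sub>C y) = cnj c * cinner x y"
  by (metis cinner_commute cinner_scaleC_left complex_cnj_mult)

lemma cinner_self: "cinner x x = complex_of_real ((norm x)\<^sup>2)"
  by (metis Re_cinner Reals_cnj_iff cinner_commute of_real_Re power2_norm_eq_inner)

lemma norm_scaleC: "norm (c *\<^sub>C x) = cmod c * norm x"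
proof (rule power2_eq_imp_eq)
  have "complex_of_real ((norm (c *\<^sub>C x))\<^sup>2) = c * cnj c * complex_of_real ((norm x)\<^sup>2)"
    unfolding cinner_self[symmetric] cinner_scaleC_left cinner_scaleC_right by (simp add: mult.assoc)
  also have "\<dots> = complex_of_real ((cmod c * norm x)\<^sup>2)"
    by (simp add: complex_norm_square[symmetric] power_mult_distrib)
  finally show "(norm (c *\<^sub>C x))\<^sup>2 = (cmod c * norm x)\<^sup>2" by (simp only: of_real_eq_iff)
qed simp_all

text \<open>The complex inner product is recovered from the real one, hence it is bounded, and so continuous
  and measurable.\<close>
lemma cinner_conv_inner: "cinner x y = Complex (inner x y) (inner ((- \<i>) *\<^sub>C x) y)"
  by (simp add: complex_eq_iff Re_cinner[symmetric] cinner_scaleC_left)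

lemma scaleR_conv_scaleC: "r *\<^sub>R x = complex_of_real r *\<^sub>C x"
  by (simp add: scaleC_of_real)

interpretation scaleC: bounded_bilinear "scaleC :: complex \<Rightarrow> 'a::separable_chilbert \<Rightarrow> 'a"
proof
  fix a a' :: complex and b b' :: 'a and r :: real
  show "(a + a') *\<^sub>C b = a *\<^sub>C b + a' *\<^sub>C b" by (rule scaleC_add_left)
  show "a *\<^sub>C (b + b') = a *\<^sub>C b + a *\<^sub>C b'" by (rule scaleC_add_right)
  show "(r *\<^sub>R a) *\<^sub>C b = r *\<^sub>R (a *\<^sub>C b)"
    by (simp add: scaleR_conv_scaleC[of r "a *\<^sub>C b"] scaleC_scaleC scaleR_conv_of_real)
  show "a *\<^sub>C (r *\<^sub>R b) = r *\<^sub>R (a *\<^sub>C b)"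
    by (simp add: scaleR_conv_scaleC scaleC_scaleC mult.commute)
  show "\<exists>K. \<forall>(a::complex) b::'a. norm (a *\<^sub>C b) \<le> norm a * norm b * K"
    by (intro exI[of _ 1]) (simp add: norm_scaleC)
qed

interpretation cinner: bounded_bilinear "cinner :: 'a::separable_chilbert \<Rightarrow> 'a \<Rightarrow> complex"
proof
  fix a a' b b' :: 'a and r :: real
  show "cinner (a + a') b = cinner a b + cinner a' b" by (rule cinner_add_left)
  show "cinner a (b + b') = cinner a b + cinner a b'"
    by (metis cinner_add_left cinner_commute complex_cnj_add)
  show "cinner (r *\<^sub>R a) b = r *\<^sub>R cinner a b" "cinner a (r *\<^sub>R b) = r *\<^sub>R cinner a b"
    by (simp_all add: scaleR_conv_scaleC cinner_scaleC_left cinner_scaleC_right scaleC_complex_def)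
  have "cmod (cinner a b) \<le> norm a * norm b * 2" for a b :: 'a
  proof -
    have "cmod (cinner a b) \<le> \<bar>inner a b\<bar> + \<bar>inner ((- \<i>) *\<^sub>C a) b\<bar>"
      using cmod_le[of "cinner a b"] by (simp add: cinner_conv_inner)
    also have "\<dots> \<le> norm a * norm b + norm ((- \<i>) *\<^sub>C a) * norm b"
      by (intro add_mono Cauchy_Schwarz_ineq2)
    finally show ?thesis by (simp add: norm_scaleC)
  qed
  then show "\<exists>K. \<forall>a b::'a. cmod (cinner a b) \<le> norm a * norm b * K" by blast
qed

lemma borel_measurable_scaleC [measurable (raw)]:
  assumes "f \<in> borel_measurable M" "g \<in> borel_measurable M"
  shows "(\<lambda>x. f x *\<^sub>C (g x :: 'a::separable_chilbert)) \<in> borel_measurable M"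
  using assms by (rule borel_measurable_continuous_Pair)
    (intro scaleC.continuous_on continuous_on_fst continuous_on_snd continuous_on_id)

lemma borel_measurable_cinner [measurable (raw)]:
  assumes "f \<in> borel_measurable M" "g \<in> borel_measurable M"
  shows "(\<lambda>x. cinner (f x) (g x :: 'a::separable_chilbert)) \<in> borel_measurable M"
  using assms by (rule borel_measurable_continuous_Pair)
    (intro cinner.continuous_on continuous_on_fst continuous_on_snd continuous_on_id)


section \<open>Weighted spaces of square integrable functions\<close>

lemma ae_rep:
  assumes "u \<in> borel_measurable unit_lebesgue"
  shows "ae_rep (ae_class u) \<in> borel_measurable unit_lebesgue"
    and "AE t in unit_lebesgue. ae_rep (ae_class u) t = u t"
proof -
  have "u \<in> ae_class u" using assms by (simp add: ae_class_def)
  then have "ae_rep (ae_class u) \<in> ae_class u" unfolding ae_rep_def by (rule someI[of "\<lambda>v. v \<in> ae_class u"])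
  then show "ae_rep (ae_class u) \<in> borel_measurable unit_lebesgue"
    "AE t in unit_lebesgue. ae_rep (ae_class u) t = u t"
    by (auto simp: ae_class_def)
qed

lemma ae_class_cong:
  assumes "AE t in unit_lebesgue. u t = v t"
  shows "ae_class u = ae_class v"
proof -
  have "(AE t in unit_lebesgue. w t = u t) \<longleftrightarrow> (AE t in unit_lebesgue. w t = v t)" for w
    using assms by (auto elim: AE_mp)
  then show ?thesis by (simp add: ae_class_def)
qed

lemma integrable_unit_const: "integrable unit_lebesgue (\<lambda>_. M :: real)"
  by (intro finite_measure.integrable_const finite_measure_lebesgue_on) simp

definition weight :: "(real \<Rightarrow> real) \<Rightarrow> bool"
  where "weight \<omega> \<longleftrightarrow> \<omega> \<in> borel_measurable unit_lebesgue \<and> (AE t in unit_lebesgue. 0 < \<omega> t)"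

definition square_integrable :: "(real \<Rightarrow> real) \<Rightarrow> (real \<Rightarrow> 'h::separable_chilbert) \<Rightarrow> bool"
  where "square_integrable \<omega> u \<longleftrightarrow> u \<in> borel_measurable unit_lebesgue \<and>
    integrable unit_lebesgue (\<lambda>t. (norm (u t))\<^sup>2 * \<omega> t)"

lemma hcarrier_weighted_L2:
  "U \<in> hcarrier (weighted_L2 \<omega>) \<longleftrightarrow> (\<exists>u. square_integrable \<omega> u \<and> U = ae_class u)"
  by (auto simp: weighted_L2_def square_integrable_def)

lemma square_integrable_measurable:
  "square_integrable \<omega> u \<Longrightarrow> u \<in> borel_measurable unit_lebesgue"
  by (simp add: square_integrable_def)

lemma hadd_ae_class:
  assumes "u \<in> borel_measurable unit_lebesgue" "v \<in> borel_measurable unit_lebesgue"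
  shows "hadd (weighted_L2 \<omega>) (ae_class u) (ae_class v) = ae_class (\<lambda>t. u t + v t)"
  unfolding weighted_L2_def hilb.simps
  by (rule ae_class_cong) (use ae_rep(2)[OF assms(1)] ae_rep(2)[OF assms(2)] in eventually_elim, simp)

lemma hscale_ae_class:
  assumes "u \<in> borel_measurable unit_lebesgue"
  shows "hscale (weighted_L2 \<omega>) c (ae_class u) = ae_class (\<lambda>t. c *\<^sub>C u t)"
  unfolding weighted_L2_def hilb.simps
  by (rule ae_class_cong) (use ae_rep(2)[OF assms(1)] in eventually_elim, simp)

lemma hdiff_ae_class:
  assumes [measurable]: "u \<in> borel_measurable unit_lebesgue" "v \<in> borel_measurable unit_lebesgue"
  shows "hdiff (weighted_L2 \<omega>) (ae_class u) (ae_class v) = ae_class (\<lambda>t. u t - v t)"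
proof -
  have "(-1) *\<^sub>C x = - x" for x :: 'a
    using scaleC_of_real[of "-1" x] by simp
  then show ?thesis by (simp add: hdiff_def hscale_ae_class hadd_ae_class)
qed

lemma hinner_ae_class:
  assumes [measurable]: "\<omega> \<in> borel_measurable unit_lebesgue"
    and u [measurable]: "u \<in> borel_measurable unit_lebesgue"
    and v [measurable]: "v \<in> borel_measurable unit_lebesgue"
  shows "hinner (weighted_L2 \<omega>) (ae_class u) (ae_class v) =
    (LINT t|unit_lebesgue. cinner (u t) (v t) * complex_of_real (\<omega> t))"
proof -
  note [measurable] = ae_rep(1)[OF u] ae_rep(1)[OF v]
  show ?thesis
    unfolding weighted_L2_def hilb.simps
    by (rule integral_cong_AE; (measurable)?)
      (use ae_rep(2)[OF u] ae_rep(2)[OF v] in eventually_elim, simp)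
qed

lemma hnorm_ae_class:
  assumes "weight \<omega>" "u \<in> borel_measurable unit_lebesgue"
  shows "(hnorm (weighted_L2 \<omega>) (ae_class u))\<^sup>2 =
    (LINT t|unit_lebesgue. (norm (u t))\<^sup>2 * \<omega> t)"
proof -
  have "hinner (weighted_L2 \<omega>) (ae_class u) (ae_class u) =
      (LINT t|unit_lebesgue. complex_of_real ((norm (u t))\<^sup>2 * \<omega> t))"
    using assms by (simp add: hinner_ae_class weight_def cinner_self)
  also have "\<dots> = complex_of_real (LINT t|unit_lebesgue. (norm (u t))\<^sup>2 * \<omega> t)"
    by (rule integral_complex_of_real)
  moreover have "0 \<le> (LINT t|unit_lebesgue. (norm (u t))\<^sup>2 * \<omega> t)"
    using assms(1) by (intro integral_nonneg_AE) (auto simp: weight_def elim!: AE_mp)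
  ultimately show ?thesis by (simp add: hnorm_def)
qed

lemma norm_add_power2_le:
  "(norm (x + y :: 'a::real_normed_vector))\<^sup>2 \<le> 2 * (norm x)\<^sup>2 + 2 * (norm y)\<^sup>2"
proof -
  have "(norm (x + y))\<^sup>2 \<le> (norm x + norm y)\<^sup>2" by (intro power_mono norm_triangle_ineq) simp
  also have "\<dots> \<le> 2 * (norm x)\<^sup>2 + 2 * (norm y)\<^sup>2"
    using zero_le_power2[of "norm x - norm y"] by (simp add: power2_eq_square algebra_simps)
  finally show ?thesis .
qed

lemma square_integrable_add:
  assumes w: "weight \<omega>" and u: "square_integrable \<omega> u" and v: "square_integrable \<omega> v"
  shows "square_integrable \<omega> (\<lambda>t. u t + v t)"
proof -
  have [measurable]: "\<omega> \<in> borel_measurable unit_lebesgue" using w by (simp add: weight_def)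
  note [measurable] = square_integrable_measurable[OF u] square_integrable_measurable[OF v]
  have pos: "AE t in unit_lebesgue. 0 < \<omega> t" using w by (simp add: weight_def)
  have "integrable unit_lebesgue
      (\<lambda>t. 2 * ((norm (u t))\<^sup>2 * \<omega> t) + 2 * ((norm (v t))\<^sup>2 * \<omega> t))"
    using u v by (auto simp: square_integrable_def)
  then have "integrable unit_lebesgue (\<lambda>t. (norm (u t + v t))\<^sup>2 * \<omega> t)"
  proof (rule Bochner_Integration.integrable_bound; (measurable)?)
    show "AE t in unit_lebesgue. norm ((norm (u t + v t))\<^sup>2 * \<omega> t) \<le>
        norm (2 * ((norm (u t))\<^sup>2 * \<omega> t) + 2 * ((norm (v t))\<^sup>2 * \<omega> t))"
      using pos
    proof eventually_elim
      case (elim t)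
      then have "(norm (u t + v t))\<^sup>2 * \<omega> t \<le> (2 * (norm (u t))\<^sup>2 + 2 * (norm (v t))\<^sup>2) * \<omega> t"
        by (intro mult_right_mono norm_add_power2_le) simp
      with elim show ?case by (simp add: algebra_simps)
    qed
  qed
  then show ?thesis by (simp add: square_integrable_def)
qed

lemma square_integrable_scaleC:
  assumes u: "square_integrable \<omega> u"
  shows "square_integrable \<omega> (\<lambda>t. c *\<^sub>C u t)"
proof -
  note [measurable] = square_integrable_measurable[OF u]
  have "integrable unit_lebesgue (\<lambda>t. (cmod c)\<^sup>2 * ((norm (u t))\<^sup>2 * \<omega> t))"
    using u by (simp add: square_integrable_def)
  then show ?thesis
    by (simp add: square_integrable_def norm_scaleC power_mult_distrib mult.assoc)
qed

lemma square_integrable_diff: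
  assumes "weight \<omega>" "square_integrable \<omega> u" "square_integrable \<omega> v"
  shows "square_integrable \<omega> (\<lambda>t. u t - v t)"
proof -
  have "square_integrable \<omega> (\<lambda>t. (-1) *\<^sub>C v t)" using assms by (intro square_integrable_scaleC)
  moreover have "(-1) *\<^sub>C x = - x" for x :: 'a
    using scaleC_of_real[of "-1" x] by simp
  ultimately show ?thesis using square_integrable_add[OF assms(1,2)] by fastforce
qed

lemma square_integrable_bounded:
  assumes [measurable]: "\<omega> \<in> borel_measurable unit_lebesgue" "u \<in> borel_measurable unit_lebesgue"
    and bound: "AE t in unit_lebesgue. \<bar>(norm (u t))\<^sup>2 * \<omega> t\<bar> \<le> M"
  shows "square_integrable \<omega> u"
proof -
  have "integrable unit_lebesgue (\<lambda>t. M)" by (rule integrable_unit_const)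
  then have "integrable unit_lebesgue (\<lambda>t. (norm (u t))\<^sup>2 * \<omega> t)"
    by (rule Bochner_Integration.integrable_bound; (measurable)?) (use bound in eventually_elim, simp)
  then show ?thesis by (simp add: square_integrable_def)
qed

text \<open>All limits in \<open>weighted_L2\<close> below come from dominated convergence with a constant majorant, which
  is integrable because the interval is bounded.\<close>
lemma hconverges_dominated:
  assumes w: "weight \<omega>"
    and [measurable]: "\<And>n. u n \<in> borel_measurable unit_lebesgue" "v \<in> borel_measurable unit_lebesgue"
    and lim: "AE t in unit_lebesgue. (\<lambda>n. u n t) \<longlonglongrightarrow> v t"
    and bound: "\<And>n. AE t in unit_lebesgue. (norm (u n t - v t))\<^sup>2 * \<omega> t \<le> M"
  shows "hconverges (weighted_L2 \<omega>) (\<lambda>n. ae_class (u n)) (ae_class v)"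
proof -
  have [measurable]: "\<omega> \<in> borel_measurable unit_lebesgue" using w by (simp add: weight_def)
  have pos: "AE t in unit_lebesgue. 0 < \<omega> t" using w by (simp add: weight_def)
  have "(\<lambda>n. LINT t|unit_lebesgue. (norm (u n t - v t))\<^sup>2 * \<omega> t) \<longlonglongrightarrow> (LINT t|unit_lebesgue. 0)"
  proof (rule integral_dominated_convergence[where w = "\<lambda>_. M"]; (measurable)?)
    show "integrable unit_lebesgue (\<lambda>t. M)" by (rule integrable_unit_const)
    show "AE t in unit_lebesgue. (\<lambda>n. (norm (u n t - v t))\<^sup>2 * \<omega> t) \<longlonglongrightarrow> 0"
      using lim
    proof eventually_elim
      case (elim t)
      have "(\<lambda>n. (norm (u n t - v t))\<^sup>2 * \<omega> t) \<longlonglongrightarrow> (norm (v t - v t))\<^sup>2 * \<omega> t"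
        by (intro tendsto_intros elim)
      then show ?case by simp
    qed
    show "AE t in unit_lebesgue. norm ((norm (u n t - v t))\<^sup>2 * \<omega> t) \<le> M" for n
      using bound[of n] pos by eventually_elim simp
  qed
  then have "(\<lambda>n. (hnorm (weighted_L2 \<omega>) (hdiff (weighted_L2 \<omega>) (ae_class (u n)) (ae_class v)))\<^sup>2) \<longlonglongrightarrow> 0"
    by (simp add: hdiff_ae_class hnorm_ae_class[OF w])
  from tendsto_real_sqrt[OF this] show ?thesis
    by (simp add: hconverges_def tendsto_rabs_zero_iff)
qed

lemma weighted_L2_quasi_triangle:
  assumes w: "weight \<omega>"
    and "U \<in> hcarrier (weighted_L2 \<omega>)" "V \<in> hcarrier (weighted_L2 \<omega>)" "W \<in> hcarrier (weighted_L2 \<omega>)"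
  shows "(hnorm (weighted_L2 \<omega>) (hdiff (weighted_L2 \<omega>) U W))\<^sup>2 \<le>
    2 * (hnorm (weighted_L2 \<omega>) (hdiff (weighted_L2 \<omega>) U V))\<^sup>2 +
    2 * (hnorm (weighted_L2 \<omega>) (hdiff (weighted_L2 \<omega>) V W))\<^sup>2"
proof -
  obtain x y z where xyz: "U = ae_class x" "V = ae_class y" "W = ae_class z"
    and sq: "square_integrable \<omega> x" "square_integrable \<omega> y" "square_integrable \<omega> z"
    using assms(2-4) unfolding hcarrier_weighted_L2 by blast
  note [measurable] = sq[THEN square_integrable_measurable]
  have int: "integrable unit_lebesgue (\<lambda>t. (norm (x t - z t))\<^sup>2 * \<omega> t)"
    "integrable unit_lebesgue (\<lambda>t. (norm (x t - y t))\<^sup>2 * \<omega> t)"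
    "integrable unit_lebesgue (\<lambda>t. (norm (y t - z t))\<^sup>2 * \<omega> t)"
    using square_integrable_diff[OF w sq(1,3)] square_integrable_diff[OF w sq(1,2)]
      square_integrable_diff[OF w sq(2,3)] by (simp_all add: square_integrable_def)
  have pos: "AE t in unit_lebesgue. 0 < \<omega> t" using w by (simp add: weight_def)
  have "(LINT t|unit_lebesgue. (norm (x t - z t))\<^sup>2 * \<omega> t) \<le>
      (LINT t|unit_lebesgue. 2 * ((norm (x t - y t))\<^sup>2 * \<omega> t) + 2 * ((norm (y t - z t))\<^sup>2 * \<omega> t))"
  proof (rule integral_mono_AE)
    show "AE t in unit_lebesgue. (norm (x t - z t))\<^sup>2 * \<omega> t \<le>
        2 * ((norm (x t - y t))\<^sup>2 * \<omega> t) + 2 * ((norm (y t - z t))\<^sup>2 * \<omega> t)"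
      using pos
    proof eventually_elim
      case (elim t)
      then have "(norm (x t - z t))\<^sup>2 * \<omega> t \<le>
          (2 * (norm (x t - y t))\<^sup>2 + 2 * (norm (y t - z t))\<^sup>2) * \<omega> t"
        using norm_add_power2_le[of "x t - y t" "y t - z t"] by (intro mult_right_mono) simp_all
      then show ?case by (simp add: algebra_simps)
    qed
  qed (use int in auto)
  then show ?thesis using int by (simp add: xyz hdiff_ae_class hnorm_ae_class[OF w])
qed

lemma weight_map_ae_class:
  assumes "u \<in> borel_measurable unit_lebesgue"
  shows "weight_map \<omega>\<^sub>1 \<omega>\<^sub>2 (ae_class u) = ae_class (\<lambda>t. sqrt (\<omega>\<^sub>1 t / \<omega>\<^sub>2 t) *\<^sub>R u t)"
  unfolding weight_map_def
  by (rule ae_class_cong) (use ae_rep(2)[OF assms] in eventually_elim, simp)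

lemma square_integrable_weight_map:
  assumes w: "weight \<omega>\<^sub>1" "weight \<omega>\<^sub>2" and u: "square_integrable \<omega>\<^sub>1 u"
  shows "square_integrable \<omega>\<^sub>2 (\<lambda>t. sqrt (\<omega>\<^sub>1 t / \<omega>\<^sub>2 t) *\<^sub>R u t)"
proof -
  have [measurable]: "\<omega>\<^sub>1 \<in> borel_measurable unit_lebesgue" "\<omega>\<^sub>2 \<in> borel_measurable unit_lebesgue"
    using w by (auto simp: weight_def)
  note [measurable] = square_integrable_measurable[OF u]
  have pos: "AE t in unit_lebesgue. 0 < \<omega>\<^sub>1 t" "AE t in unit_lebesgue. 0 < \<omega>\<^sub>2 t"
    using w by (auto simp: weight_def)
  have "integrable unit_lebesgue (\<lambda>t. (norm (u t))\<^sup>2 * \<omega>\<^sub>1 t)"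
    using u by (simp add: square_integrable_def)
  then have "integrable unit_lebesgue (\<lambda>t. (norm (sqrt (\<omega>\<^sub>1 t / \<omega>\<^sub>2 t) *\<^sub>R u t))\<^sup>2 * \<omega>\<^sub>2 t)"
    by (rule integrable_cong_AE_imp; (measurable)?)
      (use pos in eventually_elim, simp add: power_mult_distrib)
  then show ?thesis by (simp add: square_integrable_def)
qed

lemma weight_map_inverse:
  assumes w: "weight \<omega>\<^sub>1" "weight \<omega>\<^sub>2" and U: "U \<in> hcarrier (weighted_L2 \<omega>\<^sub>1)"
  shows "weight_map \<omega>\<^sub>2 \<omega>\<^sub>1 (weight_map \<omega>\<^sub>1 \<omega>\<^sub>2 U) = U"
proof -
  obtain u where u: "square_integrable \<omega>\<^sub>1 u" "U = ae_class u"
    using U by (auto simp: hcarrier_weighted_L2)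
  have pos: "AE t in unit_lebesgue. 0 < \<omega>\<^sub>1 t" "AE t in unit_lebesgue. 0 < \<omega>\<^sub>2 t"
    using w by (auto simp: weight_def)
  have "weight_map \<omega>\<^sub>2 \<omega>\<^sub>1 (weight_map \<omega>\<^sub>1 \<omega>\<^sub>2 U) =
      ae_class (\<lambda>t. sqrt (\<omega>\<^sub>2 t / \<omega>\<^sub>1 t) *\<^sub>R sqrt (\<omega>\<^sub>1 t / \<omega>\<^sub>2 t) *\<^sub>R u t)"
    using u square_integrable_weight_map[OF w u(1)]
    by (simp add: weight_map_ae_class square_integrable_measurable)
  also have "\<dots> = U"
    unfolding u(2) by (rule ae_class_cong)
      (use pos in eventually_elim, simp add: real_sqrt_mult[symmetric])
  finally show ?thesis .
qed

text \<open>Where both weights are positive, \<open>(\<surd>(\<omega>\<^sub>1 / \<omega>\<^sub>2))\<^sup>2 \<omega>\<^sub>2 = \<omega>\<^sub>1\<close>, so the integrands of the two inner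
  products agree almost everywhere.\<close>
lemma weight_map_unitary:
  fixes \<omega>\<^sub>1 \<omega>\<^sub>2 :: "real \<Rightarrow> real"
  assumes w: "weight \<omega>\<^sub>1" "weight \<omega>\<^sub>2"
  shows "hilb_unitary (weighted_L2 \<omega>\<^sub>1) (weighted_L2 \<omega>\<^sub>2)
    (weight_map \<omega>\<^sub>1 \<omega>\<^sub>2 :: (real \<Rightarrow> 'h::separable_chilbert) set \<Rightarrow> _)"
proof
  let ?F = "weight_map \<omega>\<^sub>1 \<omega>\<^sub>2 :: (real \<Rightarrow> 'h) set \<Rightarrow> _"
  have [measurable]: "\<omega>\<^sub>1 \<in> borel_measurable unit_lebesgue" "\<omega>\<^sub>2 \<in> borel_measurable unit_lebesgue"
    using w by (auto simp: weight_def)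
  have pos: "AE t in unit_lebesgue. 0 < \<omega>\<^sub>1 t" "AE t in unit_lebesgue. 0 < \<omega>\<^sub>2 t"
    using w by (auto simp: weight_def)
  have into: "weight_map \<omega> \<omega>' U \<in> hcarrier (weighted_L2 \<omega>')"
    if "weight \<omega>" "weight \<omega>'" "U \<in> hcarrier (weighted_L2 \<omega>)" for \<omega> \<omega>' and U :: "(real \<Rightarrow> 'h) set"
    using that(3) square_integrable_weight_map[OF that(1,2)]
    by (force simp: hcarrier_weighted_L2 weight_map_ae_class square_integrable_measurable)
  show "bij_betw ?F (hcarrier (weighted_L2 \<omega>\<^sub>1)) (hcarrier (weighted_L2 \<omega>\<^sub>2))"
    by (rule bij_betwI[where g = "weight_map \<omega>\<^sub>2 \<omega>\<^sub>1"])
      (auto simp: into w weight_map_inverse)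
  fix c and U V :: "(real \<Rightarrow> 'h) set"
  assume "U \<in> hcarrier (weighted_L2 \<omega>\<^sub>1)"
  then obtain u where u: "square_integrable \<omega>\<^sub>1 u" "U = ae_class u"
    by (auto simp: hcarrier_weighted_L2)
  note [measurable] = square_integrable_measurable[OF u(1)]
  show "hscale (weighted_L2 \<omega>\<^sub>1) c U \<in> hcarrier (weighted_L2 \<omega>\<^sub>1)"
    using square_integrable_scaleC[OF u(1)] by (auto simp: hcarrier_weighted_L2 u(2) hscale_ae_class)
  show "?F (hscale (weighted_L2 \<omega>\<^sub>1) c U) = hscale (weighted_L2 \<omega>\<^sub>2) c (?F U)"
    by (simp add: u(2) hscale_ae_class weight_map_ae_class scaleC.scaleR_right)
  assume "V \<in> hcarrier (weighted_L2 \<omega>\<^sub>1)"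
  then obtain v where v: "square_integrable \<omega>\<^sub>1 v" "V = ae_class v"
    by (auto simp: hcarrier_weighted_L2)
  note [measurable] = square_integrable_measurable[OF v(1)]
  show "hadd (weighted_L2 \<omega>\<^sub>1) U V \<in> hcarrier (weighted_L2 \<omega>\<^sub>1)"
    using square_integrable_add[OF w(1) u(1) v(1)]
    by (auto simp: hcarrier_weighted_L2 u(2) v(2) hadd_ae_class)
  show "?F (hadd (weighted_L2 \<omega>\<^sub>1) U V) = hadd (weighted_L2 \<omega>\<^sub>2) (?F U) (?F V)"
    by (simp add: u(2) v(2) hadd_ae_class weight_map_ae_class scaleR_add_right)
  have "AE t in unit_lebesgue. cinner (sqrt (\<omega>\<^sub>1 t / \<omega>\<^sub>2 t) *\<^sub>R u t) (sqrt (\<omega>\<^sub>1 t / \<omega>\<^sub>2 t) *\<^sub>R v t) *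
      complex_of_real (\<omega>\<^sub>2 t) = cinner (u t) (v t) * complex_of_real (\<omega>\<^sub>1 t)"
    using pos
  proof eventually_elim
    case (elim t)
    have "cinner (sqrt (\<omega>\<^sub>1 t / \<omega>\<^sub>2 t) *\<^sub>R u t) (sqrt (\<omega>\<^sub>1 t / \<omega>\<^sub>2 t) *\<^sub>R v t) * complex_of_real (\<omega>\<^sub>2 t) =
        complex_of_real (sqrt (\<omega>\<^sub>1 t / \<omega>\<^sub>2 t) * sqrt (\<omega>\<^sub>1 t / \<omega>\<^sub>2 t) * \<omega>\<^sub>2 t) * cinner (u t) (v t)"
      by (simp only: cinner.scaleR_left cinner.scaleR_right scaleR_conv_of_real of_real_mult mult_ac)
    also have "sqrt (\<omega>\<^sub>1 t / \<omega>\<^sub>2 t) * sqrt (\<omega>\<^sub>1 t / \<omega>\<^sub>2 t) * \<omega>\<^sub>2 t = \<omega>\<^sub>1 t"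
      using elim by simp
    finally show ?case by (simp only: mult.commute)
  qed
  then show "hinner (weighted_L2 \<omega>\<^sub>2) (?F U) (?F V) = hinner (weighted_L2 \<omega>\<^sub>1) U V"
    unfolding u(2) v(2)
    by (simp add: hinner_ae_class weight_map_ae_class) (rule integral_cong_AE; measurable)
qed

section \<open>Polynomial approximation of the quotient of the weights\<close>

lemma taylor_remainder_bound:
  fixes f f' f'' :: "real \<Rightarrow> real"
  assumes "\<And>t. t \<in> {0..1} \<Longrightarrow> (f has_real_derivative f' t) (at t within {0..1})"
    and "\<And>t. t \<in> {0..1} \<Longrightarrow> (f' has_real_derivative f'' t) (at t within {0..1})"
    and M: "\<And>t. t \<in> {0..1} \<Longrightarrow> \<bar>f'' t\<bar> \<le> M"
    and xy: "x \<in> {0..1}" "y \<in> {0..1}"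
  shows "\<bar>f y - f x - f' x * (y - x)\<bar> \<le> M * (y - x)\<^sup>2"
proof -
  let ?S = "closed_segment x y"
  have S: "?S \<subseteq> {0..1}" using xy by (simp add: closed_segment_subset)
  have "\<bar>(f y - f' x * y) - (f x - f' x * x)\<bar> \<le> (M * \<bar>y - x\<bar>) * \<bar>y - x\<bar>"
  proof (rule field_differentiable_bound[where S = ?S, unfolded real_norm_def])
    fix s assume s: "s \<in> ?S"
    then have "(f has_real_derivative f' s) (at s within ?S)"
      using S assms(1) by (blast intro: DERIV_subset)
    then show "((\<lambda>s. f s - f' x * s) has_real_derivative f' s - f' x) (at s within ?S)"
      by (auto intro!: derivative_eq_intros)
    have "\<bar>f' s - f' x\<bar> \<le> M * \<bar>s - x\<bar>"
      using assms(2) M s S xy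
      by (intro field_differentiable_bound[where S = "{0..1}" and f' = f'', unfolded real_norm_def]) auto
    also have "\<dots> \<le> M * \<bar>y - x\<bar>"
      using s M[OF xy(1)] by (intro mult_left_mono) (auto simp: closed_segment_eq_real_ivl split: if_splits)
    finally show "\<bar>f' s - f' x\<bar> \<le> M * \<bar>y - x\<bar>" .
  qed auto
  then show ?thesis by (simp add: algebra_simps power2_eq_square)
qed

text \<open>Glaeser's inequality: a nonnegative function of class \<open>C\<^sup>2\<close> has a locally Lipschitz square root.
  A Newton-like step from \<open>t\<close> of length proportional to \<open>f' t\<close> would otherwise reach a negative
  value. The step must stay inside the unit interval, so the bound holds only away from the end
  points, where \<open>f t = t\<close> violates it.\<close>
lemma nonneg_C2_derivative_bound:
  fixes f f' f'' :: "real \<Rightarrow> real"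
  assumes f: "\<And>t. t \<in> {0..1} \<Longrightarrow> (f has_real_derivative f' t) (at t within {0..1})"
    and f': "\<And>t. t \<in> {0..1} \<Longrightarrow> (f' has_real_derivative f'' t) (at t within {0..1})"
    and f'': "continuous_on {0..1} f''"
    and nonneg: "\<And>t. t \<in> {0..1} \<Longrightarrow> 0 \<le> f t" and ab: "0 < a" "b < 1"
  obtains N where "0 < N" "\<And>t. t \<in> {a..b} \<Longrightarrow> (f' t)\<^sup>2 \<le> N * f t"
proof -
  have bounded: "\<exists>B\<ge>0. \<forall>t\<in>{0..1}. \<bar>g t\<bar> \<le> B" if "continuous_on {0..1} g" for g :: "real \<Rightarrow> real"
    using compact_imp_bounded[OF compact_continuous_image[OF that compact_Icc]]
    unfolding bounded_iff by (auto intro: order_trans[OF abs_ge_zero])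
  obtain M where M: "M \<ge> 0" "\<And>t. t \<in> {0..1} \<Longrightarrow> \<bar>f'' t\<bar> \<le> M" using bounded[OF f''] by blast
  have "continuous_on {0..1} f'" using f' by (intro DERIV_continuous_on)
  then obtain L where L: "L \<ge> 0" "\<And>t. t \<in> {0..1} \<Longrightarrow> \<bar>f' t\<bar> \<le> L" using bounded by blast
  define d where "d = min a (1 - b)"
  have d: "0 < d" using ab by (simp add: d_def)
  \<comment> \<open>\<open>N \<ge> M\<close> makes the quadratic term of the Taylor bound harmless, \<open>N \<ge> L / d\<close> keeps the step within
    distance \<open>d\<close> of \<open>t\<close>.\<close>
  define N where "N = M + L / d + 1"
  have N: "M \<le> N" "L / d \<le> N" "0 < N" using M(1) divide_nonneg_pos[OF L(1) d] by (auto simp: N_def)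
  have "(f' t)\<^sup>2 \<le> 4 * N * f t" if t: "t \<in> {a..b}" for t
  proof -
    define h where "h = - f' t / (2 * N)"
    have t01: "t \<in> {0..1}" using t ab by auto
    have "\<bar>f' t\<bar> \<le> d * N" using L(2)[OF t01] N(2) d by (simp add: field_simps)
    then have "\<bar>h\<bar> \<le> d" using N(3) mult_nonneg_nonneg[of d N] d by (simp add: h_def field_simps)
    then have th: "t + h \<in> {0..1}" using t by (auto simp: d_def abs_le_iff)
    have "0 \<le> f (t + h)" using nonneg th .
    also have "f (t + h) \<le> f t + f' t * h + M * h\<^sup>2"
      using taylor_remainder_bound[OF f f' M(2) t01 th] by simp
    also have "\<dots> \<le> f t + f' t * h + N * h\<^sup>2" using N(1) by (simp add: mult_right_mono)
    also have "f' t * h + N * h\<^sup>2 = - (f' t)\<^sup>2 / (4 * N)"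
      using N(3) by (simp add: h_def power2_eq_square field_simps)
    then have "f t + f' t * h + N * h\<^sup>2 = f t - (f' t)\<^sup>2 / (4 * N)" by simp
    finally show ?thesis using N(3) by (simp add: field_simps)
  qed
  then show ?thesis using that[of "4 * N"] N(3) by simp
qed

text \<open>Weierstrass approximation of \<open>f'\<close>, integrated once.\<close>
lemma C1_polynomial_approx:
  fixes f f' :: "real \<Rightarrow> real"
  assumes f: "\<And>t. t \<in> {a..b} \<Longrightarrow> (f has_real_derivative f' t) (at t within {a..b})"
    and f': "continuous_on {a..b} f'" and ab: "a \<le> b" and e: "0 < e"
  obtains p p' where "real_polynomial_function p" "\<And>t. (p has_real_derivative p' t) (at t)"
    "\<And>t. t \<in> {a..b} \<Longrightarrow> \<bar>p t - f t\<bar> \<le> e" "\<And>t. t \<in> {a..b} \<Longrightarrow> \<bar>p' t - f' t\<bar> \<le> e"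
proof -
  define d where "d = e / (1 + (b - a))"
  have d: "0 < d" "d \<le> e" "d * (b - a) \<le> e" using ab e by (auto simp: d_def field_simps)
  obtain q where q: "real_polynomial_function q" "\<And>t. t \<in> {a..b} \<Longrightarrow> \<bar>f' t - q t\<bar> < d"
    using Stone_Weierstrass_real_polynomial_function[OF compact_Icc f' d(1)] by blast
  obtain c n where c: "q = (\<lambda>t. \<Sum>i\<le>n. c i * t ^ i)"
    using q(1) unfolding real_polynomial_function_iff_sum by blast
  define r where "r = (\<lambda>t. \<Sum>i\<le>n. c i / real (Suc i) * t ^ Suc i)"
  have r: "real_polynomial_function r"
    unfolding r_def by (intro real_polynomial_function_sum real_polynomial_function_power
        real_polynomial_function.intros(2,4) real_polynomial_function.intros(1)[OF bounded_linear_ident]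
        finite_atMost)
  have r': "(r has_real_derivative q t) (at t)" for t
    unfolding r_def c
  proof (rule DERIV_sum)
    show "((\<lambda>t. c i / real (Suc i) * t ^ Suc i) has_real_derivative c i * t ^ i) (at t)" for i
      using DERIV_cmult[OF DERIV_pow[of "Suc i" t], of "c i / real (Suc i)"]
      by (simp del: of_nat_Suc)
  qed
  define p where "p = (\<lambda>t. r t + (f a - r a))"
  have p: "real_polynomial_function p"
    unfolding p_def by (intro real_polynomial_function.intros(3) r real_polynomial_function.intros(2))
  have p': "(p has_real_derivative q t) (at t)" for t
    unfolding p_def by (auto intro!: derivative_eq_intros r')
  have q_le: "\<bar>q t - f' t\<bar> \<le> d" if "t \<in> {a..b}" for t using q(2)[OF that] by simp
  have "\<bar>p t - f t\<bar> \<le> e" if t: "t \<in> {a..b}" for t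
  proof -
    have "\<bar>(p t - f t) - (p a - f a)\<bar> \<le> d * \<bar>t - a\<bar>"
      using t ab q_le
      by (intro field_differentiable_bound[where S = "{a..b}" and f' = "\<lambda>t. q t - f' t",
            unfolded real_norm_def])
        (auto intro!: derivative_eq_intros f intro: DERIV_subset[OF p'])
    also have "\<dots> \<le> d * (b - a)" using t d(1) by (intro mult_left_mono) auto
    finally show ?thesis using d(3) by (simp add: p_def)
  qed
  then show ?thesis using that[OF p p'] q_le d(2) by fastforce
qed

lemma C2_on_unit_derivatives:
  fixes f :: "real \<Rightarrow> real"
  assumes "C2_on_unit f"
  obtains f' f'' where
    "\<And>t. t \<in> {0..1} \<Longrightarrow> (f has_real_derivative f' t) (at t within {0..1})"
    "\<And>t. t \<in> {0..1} \<Longrightarrow> (f' has_real_derivative f'' t) (at t within {0..1})"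
    "continuous_on {0..1} f''"
    "\<And>t. t \<in> {0<..<1} \<Longrightarrow> (f has_real_derivative f' t) (at t)"
    "\<And>t. t \<in> {0<..<1} \<Longrightarrow> deriv f t = f' t"
proof -
  obtain f' f'' where f:
    "\<And>t. t \<in> {0..1} \<Longrightarrow> (f has_real_derivative f' t) (at t within {0..1})"
    "\<And>t. t \<in> {0..1} \<Longrightarrow> (f' has_real_derivative f'' t) (at t within {0..1})"
    "continuous_on {0..1} f''"
    using assms unfolding C2_on_unit_def C1_on_unit_def
    unfolding has_real_derivative_iff_has_vector_derivative by blast
  have "(f has_real_derivative f' t) (at t)" if "t \<in> {0<..<1}" for t
    using f(1)[of t] that at_within_interior[of t "{0..1::real}"] by simp
  with f that show ?thesis by (metis DERIV_imp_deriv)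
qed

text \<open>The function \<open>\<surd>(\<beta> / \<alpha>)\<close> need not be differentiable at zeros of \<open>\<beta>\<close>, but \<open>\<surd>((\<beta> + \<epsilon>) / \<alpha>)\<close> is of class
  \<open>C\<^sup>1\<close>, so it is \<open>\<epsilon>\<close>-close to a polynomial together with its derivative. As \<open>\<epsilon>\<close> tends to 0 the
  derivatives converge wherever \<open>\<beta>\<close> is positive, and Glaeser's inequality bounds them uniformly in
  \<open>\<epsilon>\<close>: \<open>\<bar>\<beta>'\<bar> / \<surd>(\<beta> + \<epsilon>)\<close> stays bounded. The limit is the weak derivative of \<open>\<surd>(\<beta> / \<alpha>)\<close>, namely
  \<open>\<surd>(\<beta> / \<alpha>)\<close> times the difference of the logarithmic drifts.\<close>
lemma sqrt_quotient_polynomial_approx: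
  fixes \<alpha> \<beta> :: "real \<Rightarrow> real"
  assumes C2: "C2_on_unit \<alpha>" "C2_on_unit \<beta>"
    and \<alpha>_pos: "\<And>t. t \<in> {0<..<1} \<Longrightarrow> 0 < \<alpha> t" and \<beta>_nonneg: "\<And>t. t \<in> {0..1} \<Longrightarrow> 0 \<le> \<beta> t"
    and ab: "0 < a" "a \<le> b" "b < 1"
  obtains P P' M where "\<And>n. real_polynomial_function (P n)"
    "\<And>n t. (P n has_real_derivative P' n t) (at t)"
    "\<And>n t. t \<in> {a..b} \<Longrightarrow> \<bar>P n t\<bar> \<le> M" "\<And>n t. t \<in> {a..b} \<Longrightarrow> \<bar>P' n t\<bar> \<le> M"
    "\<And>t. t \<in> {a..b} \<Longrightarrow> (\<lambda>n. P n t) \<longlonglongrightarrow> sqrt (\<beta> t / \<alpha> t)"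
    "\<And>t. t \<in> {a..b} \<Longrightarrow> 0 < \<beta> t \<Longrightarrow>
      (\<lambda>n. P' n t) \<longlonglongrightarrow> sqrt (\<beta> t / \<alpha> t) * (log_drift \<beta> t - log_drift \<alpha> t)"
proof -
  obtain \<alpha>' \<alpha>'' where \<alpha>: 
    "\<And>t. t \<in> {0..1} \<Longrightarrow> (\<alpha> has_real_derivative \<alpha>' t) (at t within {0..1})"
    "\<And>t. t \<in> {0..1} \<Longrightarrow> (\<alpha>' has_real_derivative \<alpha>'' t) (at t within {0..1})"
    "\<And>t. t \<in> {0<..<1} \<Longrightarrow> (\<alpha> has_real_derivative \<alpha>' t) (at t)"
    "\<And>t. t \<in> {0<..<1} \<Longrightarrow> deriv \<alpha> t = \<alpha>' t"
    using C2_on_unit_derivatives[OF C2(1)] by metis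
  obtain \<beta>' \<beta>'' where \<beta>: 
    "\<And>t. t \<in> {0..1} \<Longrightarrow> (\<beta> has_real_derivative \<beta>' t) (at t within {0..1})"
    "\<And>t. t \<in> {0..1} \<Longrightarrow> (\<beta>' has_real_derivative \<beta>'' t) (at t within {0..1})"
    "continuous_on {0..1} \<beta>''"
    "\<And>t. t \<in> {0<..<1} \<Longrightarrow> (\<beta> has_real_derivative \<beta>' t) (at t)"
    "\<And>t. t \<in> {0<..<1} \<Longrightarrow> deriv \<beta> t = \<beta>' t"
    using C2_on_unit_derivatives[OF C2(2)] by metis
  have sub: "{a..b} \<subseteq> {0<..<1}" "{a..b} \<subseteq> {0..1}" using ab by auto
  have cont: "continuous_on {a..b} \<alpha>" "continuous_on {a..b} \<alpha>'"
      "continuous_on {a..b} \<beta>" "continuous_on {a..b} \<beta>'"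
    using DERIV_continuous_on[OF \<alpha>(1)] DERIV_continuous_on[OF \<alpha>(2)]
      DERIV_continuous_on[OF \<beta>(1)] DERIV_continuous_on[OF \<beta>(2)]
    by (auto intro: continuous_on_subset[OF _ sub(2)])
  have bounded: "\<exists>B\<ge>0. \<forall>t\<in>{a..b}. \<bar>g t\<bar> \<le> B" if g: "continuous_on {a..b} g" for g :: "real \<Rightarrow> real"
  proof -
    obtain B where "\<forall>t\<in>{a..b}. \<bar>g t\<bar> \<le> B"
      using compact_imp_bounded[OF compact_continuous_image[OF g compact_Icc]]
      unfolding bounded_iff by auto
    then show ?thesis by (intro exI[of _ "\<bar>B\<bar>"]) auto
  qed
  obtain N where N: "0 < N" "\<And>t. t \<in> {a..b} \<Longrightarrow> (\<beta>' t)\<^sup>2 \<le> N * \<beta> t"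
    using nonneg_C2_derivative_bound[OF \<beta>(1-3) \<beta>_nonneg ab(1,3)] by blast
  have \<alpha>0: "0 < \<alpha> t" if "t \<in> {a..b}" for t using \<alpha>_pos that sub by blast
  have \<beta>0: "0 \<le> \<beta> t" if "t \<in> {a..b}" for t using \<beta>_nonneg that sub by blast
  have inv: "continuous_on {a..b} (\<lambda>t. 1 / \<alpha> t)"
    using cont(1) \<alpha>0 by (intro continuous_intros) (auto simp: less_imp_neq[symmetric])
  obtain m where m: "0 \<le> m" "\<And>t. t \<in> {a..b} \<Longrightarrow> 1 / \<alpha> t \<le> m"
    using bounded[OF inv] by (meson abs_ge_self order_trans)
  obtain B where B: "0 \<le> B" "\<And>t. t \<in> {a..b} \<Longrightarrow> \<beta> t \<le> B"
    using bounded[OF cont(3)] by (auto simp: abs_le_iff)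
  obtain R where R: "0 \<le> R" "\<And>t. t \<in> {a..b} \<Longrightarrow> \<bar>\<alpha>' t / \<alpha> t\<bar> \<le> R"
    using bounded[OF continuous_on_mult[OF cont(2) inv]] by auto
  define \<epsilon> where "\<epsilon> n = 1 / real (Suc n)" for n
  have \<epsilon>: "0 < \<epsilon> n" "\<epsilon> n \<le> 1" for n by (auto simp: \<epsilon>_def)
  have \<epsilon>_lim: "\<epsilon> \<longlonglongrightarrow> 0" unfolding \<epsilon>_def by (rule LIMSEQ_Suc[OF lim_1_over_n])
  define w where "w n t = sqrt ((\<beta> t + \<epsilon> n) / \<alpha> t)" for n t
  define w' where "w' n t = w n t * (\<beta>' t / (2 * (\<beta> t + \<epsilon> n)) - \<alpha>' t / (2 * \<alpha> t))" for n t
  have \<beta>\<epsilon>: "0 < \<beta> t + \<epsilon> n" if "t \<in> {a..b}" for t n using \<beta>0[OF that] \<epsilon>(1)[of n] by simp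
  have w_deriv: "(w n has_real_derivative w' n t) (at t within {a..b})" if t: "t \<in> {a..b}" for n t
  proof -
    have pos: "0 < (\<beta> t + \<epsilon> n) / \<alpha> t" using \<beta>\<epsilon>[OF t] \<alpha>0[OF t] by simp
    have s: "sqrt ((\<beta> t + \<epsilon> n) / \<alpha> t) * sqrt ((\<beta> t + \<epsilon> n) / \<alpha> t) = (\<beta> t + \<epsilon> n) / \<alpha> t"
      using pos by (simp only: real_sqrt_mult_self abs_of_pos)
    have "((\<lambda>t. (\<beta> t + \<epsilon> n) / \<alpha> t) has_real_derivative
        (\<beta>' t * \<alpha> t - (\<beta> t + \<epsilon> n) * \<alpha>' t) / (\<alpha> t * \<alpha> t)) (at t)"
      using t sub \<alpha>0[OF t] by (auto intro!: derivative_eq_intros \<alpha>(3) \<beta>(4))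
    from DERIV_chain2[OF DERIV_real_sqrt[OF pos] this]
    have "(w n has_real_derivative inverse (sqrt ((\<beta> t + \<epsilon> n) / \<alpha> t)) / 2 *
        ((\<beta>' t * \<alpha> t - (\<beta> t + \<epsilon> n) * \<alpha>' t) / (\<alpha> t * \<alpha> t))) (at t)"
      unfolding w_def .
    also have "inverse (sqrt ((\<beta> t + \<epsilon> n) / \<alpha> t)) = w n t * (\<alpha> t / (\<beta> t + \<epsilon> n))"
      using s pos \<alpha>0[OF t] \<beta>\<epsilon>[OF t, of n] unfolding w_def
      by (intro inverse_unique) (simp add: mult.assoc[symmetric])
    also have "w n t * (\<alpha> t / (\<beta> t + \<epsilon> n)) / 2 *
        ((\<beta>' t * \<alpha> t - (\<beta> t + \<epsilon> n) * \<alpha>' t) / (\<alpha> t * \<alpha> t)) = w' n t"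
    proof -
      have "z * (x / y) / 2 * ((p * x - y * q) / (x * x)) = z * (p / (2 * y) - q / (2 * x))"
        if "0 < x" "0 < y" for p q x y z :: real
        using that by (simp add: divide_simps)
      then show ?thesis unfolding w'_def using \<alpha>0[OF t] \<beta>\<epsilon>[OF t, of n] by blast
    qed
    finally show ?thesis by (rule DERIV_subset) simp
  qed
  have w'_cont: "continuous_on {a..b} (w' n)" for n
  proof -
    have "\<alpha> t \<noteq> 0" "2 * (\<beta> t + \<epsilon> n) \<noteq> 0" if "t \<in> {a..b}" for t
      using \<alpha>0[OF that] \<beta>\<epsilon>[OF that, of n] by auto
    then show ?thesis unfolding w'_def w_def by (intro continuous_intros cont ballI) auto
  qed
  define M where "M = sqrt ((B + 1) * m) + sqrt (N * m) + sqrt ((B + 1) * m) * R + 1"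
  have w_bound: "\<bar>w n t\<bar> \<le> sqrt ((B + 1) * m)" if t: "t \<in> {a..b}" for n t
  proof -
    have "(\<beta> t + \<epsilon> n) * (1 / \<alpha> t) \<le> (B + 1) * m"
      using B m(1) m(2)[OF t] \<alpha>0[OF t] \<epsilon>(2)[of n] B(2)[OF t] by (intro mult_mono) auto
    then show ?thesis using \<alpha>0[OF t] \<beta>\<epsilon>[OF t, of n] by (simp add: w_def)
  qed
  have w'_bound: "\<bar>w' n t\<bar> \<le> sqrt (N * m) + sqrt ((B + 1) * m) * R" if t: "t \<in> {a..b}" for n t
  proof -
    have "(w n t * (\<beta>' t / (2 * (\<beta> t + \<epsilon> n))))\<^sup>2 =
        (\<beta>' t)\<^sup>2 / (\<beta> t + \<epsilon> n) * (1 / \<alpha> t) * (1 / 4)"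
    proof -
      have "(sqrt (y / x) * (p / (2 * y)))\<^sup>2 = p\<^sup>2 / y * (1 / x) * (1 / 4)"
        if "0 < x" "0 < y" for p x y :: real
      proof -
        have "(sqrt (y / x) * (p / (2 * y)))\<^sup>2 = y / x * (p / (2 * y))\<^sup>2"
          using that by (simp only: power_mult_distrib real_sqrt_pow2 divide_nonneg_pos less_imp_le)
        also have "\<dots> = p\<^sup>2 / y * (1 / x) * (1 / 4)"
          using that by (simp add: power2_eq_square field_simps)
        finally show ?thesis .
      qed
      then show ?thesis unfolding w_def using \<alpha>0[OF t] \<beta>\<epsilon>[OF t, of n] by blast
    qed
    also have "\<dots> \<le> (\<beta>' t)\<^sup>2 / (\<beta> t + \<epsilon> n) * (1 / \<alpha> t)"
      using \<alpha>0[OF t] \<beta>\<epsilon>[OF t, of n] by (intro mult_left_le) auto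
    also have "\<dots> \<le> N * m"
    proof (intro mult_mono)
      have "(\<beta>' t)\<^sup>2 \<le> N * (\<beta> t + \<epsilon> n)"
        using N(2)[OF t] N(1) \<epsilon>(1)[of n] by (simp add: distrib_left add_increasing2)
      then show "(\<beta>' t)\<^sup>2 / (\<beta> t + \<epsilon> n) \<le> N" using \<beta>\<epsilon>[OF t, of n] by (simp add: divide_le_eq)
    qed (use N m(2)[OF t] \<alpha>0[OF t] in auto)
    finally have 1: "\<bar>w n t * (\<beta>' t / (2 * (\<beta> t + \<epsilon> n)))\<bar> \<le> sqrt (N * m)"
      by (intro real_le_rsqrt) (simp only: power2_abs)
    have "\<bar>w n t * (\<alpha>' t / (2 * \<alpha> t))\<bar> = \<bar>w n t\<bar> * (\<bar>\<alpha>' t / \<alpha> t\<bar> / 2)"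
      by (simp add: abs_mult)
    also have "\<dots> \<le> sqrt ((B + 1) * m) * R"
    proof (rule mult_mono[OF w_bound[OF t]])
      have half_le: "x / 2 \<le> R" if "0 \<le> x" "x \<le> R" for x :: real using that by simp
      show "\<bar>\<alpha>' t / \<alpha> t\<bar> / 2 \<le> R" 
        using half_le R(2)[OF t] abs_ge_zero by blast
    qed (use B(1) m(1) in auto)
    finally show ?thesis using 1 unfolding w'_def right_diff_distrib
      by (meson abs_triangle_ineq4 add_mono order_trans)
  qed
  have "\<exists>p p'. real_polynomial_function p \<and> (\<forall>t. (p has_real_derivative p' t) (at t)) \<and>
      (\<forall>t\<in>{a..b}. \<bar>p t - w n t\<bar> \<le> \<epsilon> n) \<and> (\<forall>t\<in>{a..b}. \<bar>p' t - w' n t\<bar> \<le> \<epsilon> n)" for n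
    using C1_polynomial_approx[OF w_deriv w'_cont ab(2) \<epsilon>(1)] by metis
  then obtain P P' where P: "\<And>n. real_polynomial_function (P n)"
    "\<And>n t. (P n has_real_derivative P' n t) (at t)"
    "\<And>n t. t \<in> {a..b} \<Longrightarrow> \<bar>P n t - w n t\<bar> \<le> \<epsilon> n"
    "\<And>n t. t \<in> {a..b} \<Longrightarrow> \<bar>P' n t - w' n t\<bar> \<le> \<epsilon> n"
    by metis
  have close: "(\<lambda>n. p n) \<longlonglongrightarrow> l" if "\<And>n. \<bar>p n - q n\<bar> \<le> \<epsilon> n" "q \<longlonglongrightarrow> l" for p q :: "nat \<Rightarrow> real" and l
  proof -
    have "(\<lambda>n. p n - q n) \<longlonglongrightarrow> 0"
      by (rule Lim_null_comparison[OF _ \<epsilon>_lim]) (simp add: that(1))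
    from tendsto_add[OF this that(2)] show ?thesis by simp
  qed
  show ?thesis
  proof (rule that[of P P' M])
    have nn: "0 \<le> sqrt ((B + 1) * m)" "0 \<le> sqrt (N * m)" using B(1) m(1) N(1) by auto
    then have "0 \<le> sqrt ((B + 1) * m) * R" using R(1) by simp
    note nn = nn this
    fix n t assume t: "t \<in> {a..b}"
    show "\<bar>P n t\<bar> \<le> M" using P(3)[OF t, of n] w_bound[OF t, of n] \<epsilon>(2)[of n] nn unfolding M_def by linarith
    show "\<bar>P' n t\<bar> \<le> M" using P(4)[OF t, of n] w'_bound[OF t, of n] \<epsilon>(2)[of n] nn unfolding M_def by linarith
  next
    fix t assume t: "t \<in> {a..b}"
    have "(\<lambda>n. w n t) \<longlonglongrightarrow> sqrt ((\<beta> t + 0) / \<alpha> t)"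
      unfolding w_def using \<alpha>0[OF t] by (intro tendsto_intros \<epsilon>_lim) auto
    then have w_lim: "(\<lambda>n. w n t) \<longlonglongrightarrow> sqrt (\<beta> t / \<alpha> t)" by simp
    show "(\<lambda>n. P n t) \<longlonglongrightarrow> sqrt (\<beta> t / \<alpha> t)" using P(3)[OF t] w_lim by (rule close)
    assume "0 < \<beta> t"
    then have "(\<lambda>n. w' n t) \<longlonglongrightarrow> sqrt (\<beta> t / \<alpha> t) * (\<beta>' t / (2 * (\<beta> t + 0)) - \<alpha>' t / (2 * \<alpha> t))"
      unfolding w'_def using \<alpha>0[OF t] by (intro tendsto_intros \<epsilon>_lim w_lim) auto
    also have "\<beta>' t / (2 * (\<beta> t + 0)) - \<alpha>' t / (2 * \<alpha> t) = log_drift \<beta> t - log_drift \<alpha> t"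
      using t sub(1) by (simp add: log_drift_def \<alpha>(4) \<beta>(5) subset_iff)
    finally show "(\<lambda>n. P' n t) \<longlonglongrightarrow> sqrt (\<beta> t / \<alpha> t) * (log_drift \<beta> t - log_drift \<alpha> t)"
      by (rule close[OF P(4)[OF t]])
  qed (use P in auto)
qed

lemma continuous_AE_zero:
  fixes h :: "real \<Rightarrow> real"
  assumes h: "continuous_on {0<..<1} h" and ae: "AE t in unit_lebesgue. h t = 0" and t: "t \<in> {0<..<1}"
  shows "h t = 0"
proof (rule ccontr)
  assume "h t \<noteq> 0"
  define S where "S = {0<..<1} \<inter> h -` (- {0})"
  have S: "open S" unfolding S_def
    using h by (rule continuous_open_preimage) auto
  have "AE t in lebesgue. t \<in> {0<..<1} \<longrightarrow> h t = 0"
    using ae by (simp add: AE_restrict_space_iff)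
  then have "AE t in lebesgue. t \<notin> S" by eventually_elim (auto simp: S_def)
  then have "negligible S"
    using S by (simp add: negligible_iff_null_sets AE_iff_null_sets lebesgue_openin)
  moreover have "t \<in> S" using t \<open>h t \<noteq> 0\<close> by (simp add: S_def)
  ultimately show False using S open_not_negligible by blast
qed

text \<open>The equation \<open>\<omega>' = 2 g \<omega>\<close> holds almost everywhere, hence everywhere by continuity of both sides,
  so \<open>\<omega>\<close> is a constant multiple of \<open>exp (2 \<integral> g)\<close>.\<close>
lemma continuous_log_drift_imp_pos:
  fixes \<omega> :: "real \<Rightarrow> real"
  assumes C2: "C2_on_unit \<omega>" and pos: "AE t in unit_lebesgue. 0 < \<omega> t"
    and g: "continuous_on {0..1} g" and drift: "AE t in unit_lebesgue. log_drift \<omega> t = g t"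
    and t: "t \<in> {0<..<1}"
  shows "0 < \<omega> t"
proof -
  obtain \<omega>' \<omega>'' where \<omega>:
    "\<And>t. t \<in> {0..1} \<Longrightarrow> (\<omega> has_real_derivative \<omega>' t) (at t within {0..1})"
    "\<And>t. t \<in> {0..1} \<Longrightarrow> (\<omega>' has_real_derivative \<omega>'' t) (at t within {0..1})"
    "\<And>t. t \<in> {0<..<1} \<Longrightarrow> (\<omega> has_real_derivative \<omega>' t) (at t)"
    "\<And>t. t \<in> {0<..<1} \<Longrightarrow> deriv \<omega> t = \<omega>' t"
    using C2_on_unit_derivatives[OF C2] by metis
  have "continuous_on {0..1} (\<lambda>t. \<omega>' t - 2 * g t * \<omega> t)"
    by (intro continuous_intros g DERIV_continuous_on[OF \<omega>(1)] DERIV_continuous_on[OF \<omega>(2)])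
  then have "continuous_on {0<..<1} (\<lambda>t. \<omega>' t - 2 * g t * \<omega> t)"
    by (rule continuous_on_subset) auto
  moreover have "AE t in unit_lebesgue. \<omega>' t - 2 * g t * \<omega> t = 0"
    using pos drift AE_space
  proof eventually_elim
    case (elim t)
    then have "deriv \<omega> t = \<omega>' t" using \<omega>(4) by simp
    with elim show ?case by (auto simp: log_drift_def field_simps)
  qed
  ultimately have ode: "\<omega>' t = 2 * g t * \<omega> t" if "t \<in> {0<..<1}" for t
    using continuous_AE_zero[OF _ _ that] by force
  obtain G where G0: "\<And>t. t \<in> {0..1} \<Longrightarrow> (G has_vector_derivative g t) (at t within {0..1})"
    using antiderivative_continuous[OF g] by blast
  then have G: "(G has_real_derivative g t) (at t)" if "t \<in> {0<..<1}" for t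
  proof -
    have "t \<in> {0..1}" using that by simp
    then have "(G has_vector_derivative g t) (at t within {0..1})" by (rule G0)
    moreover have "at t within {0..1} = at t" using that by (intro at_within_interior) simp
    ultimately show ?thesis by (simp add: has_real_derivative_iff_has_vector_derivative)
  qed
  have "((\<lambda>t. \<omega> t * exp (- 2 * G t)) has_real_derivative 0) (at t within {0<..<1})"
    if "t \<in> {0<..<1}" for t
  proof -
    have "((\<lambda>t. - 2 * G t) has_real_derivative - 2 * g t) (at t)"
      by (rule DERIV_cmult[OF G[OF that]])
    then have "((\<lambda>t. exp (- 2 * G t)) has_real_derivative exp (- 2 * G t) * (- 2 * g t)) (at t)"
      by (rule DERIV_chain2[OF DERIV_exp])
    from DERIV_mult[OF \<omega>(3)[OF that] this] have
      "((\<lambda>t. \<omega> t * exp (- 2 * G t)) has_real_derivative 0) (at t)"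
      by (simp add: ode[OF that] mult_ac)
    then show ?thesis by (rule has_field_derivative_at_within)
  qed
  then have "\<exists>c. \<forall>t\<in>{0<..<1}. \<omega> t * exp (- 2 * G t) = c"
    by (intro has_field_derivative_zero_constant convex_real_interval)
  then obtain c where c: "\<And>t. t \<in> {0<..<1} \<Longrightarrow> \<omega> t * exp (- 2 * G t) = c" by blast
  have "c > 0"
  proof (rule ccontr)
    assume "\<not> c > 0"
    then have neg: "\<not> 0 < \<omega> t" if "t \<in> {0<..<1}" for t
      using c[OF that] by (metis exp_gt_zero mult_pos_pos)
    have "AE t in unit_lebesgue. (1::real) = 0"
      using pos AE_space by eventually_elim (use neg in auto)
    from continuous_AE_zero[OF _ this, of "1/2"] show False by simp
  qed
  with c[OF t] show ?thesis by (metis exp_gt_zero zero_less_mult_pos2)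
qed

section \<open>Test functions\<close>

lemma test_function_scale:
  assumes "test_function \<phi>"
  shows "test_function (\<lambda>t. c * \<phi> t)"
proof -
  obtain D a b where D: "D 0 = \<phi>" "\<And>n t. (D n has_vector_derivative D (Suc n) t) (at t)"
    and ab: "0 < a" "b < 1" "\<And>t. t \<notin> {a..b} \<Longrightarrow> \<phi> t = 0"
    using assms unfolding test_function_def by blast
  have "((\<lambda>t. c * D n t) has_vector_derivative c * D (Suc n) t) (at t)" for n t
    using D(2) by (rule has_vector_derivative_mult_right)
  with D(1) have "\<exists>D. D 0 = (\<lambda>t. c * \<phi> t) \<and> (\<forall>n t. (D n has_vector_derivative D (Suc n) t) (at t))"
    by (intro exI[of _ "\<lambda>n t. c * D n t"]) auto
  moreover have "\<exists>a b. 0 < a \<and> b < 1 \<and> (\<forall>t. t \<notin> {a..b} \<longrightarrow> c * \<phi> t = 0)"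
    using ab by (intro exI[of _ a] exI[of _ b]) auto
  ultimately show ?thesis by (simp add: test_function_def)
qed

lemma test_function_add:
  assumes "test_function \<phi>" "test_function \<psi>"
  shows "test_function (\<lambda>t. \<phi> t + \<psi> t)"
proof -
  obtain D a b where D: "D 0 = \<phi>" "\<And>n t. (D n has_vector_derivative D (Suc n) t) (at t)"
    and ab: "0 < a" "b < 1" "\<And>t. t \<notin> {a..b} \<Longrightarrow> \<phi> t = 0"
    using assms(1) unfolding test_function_def by blast
  obtain E c d where E: "E 0 = \<psi>" "\<And>n t. (E n has_vector_derivative E (Suc n) t) (at t)"
    and cd: "0 < c" "d < 1" "\<And>t. t \<notin> {c..d} \<Longrightarrow> \<psi> t = 0"
    using assms(2) unfolding test_function_def by blast
  have "((\<lambda>t. D n t + E n t) has_vector_derivative D (Suc n) t + E (Suc n) t) (at t)" for n t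
    by (intro has_vector_derivative_add D E)
  with D(1) E(1) have "\<exists>D. D 0 = (\<lambda>t. \<phi> t + \<psi> t) \<and>
      (\<forall>n t. (D n has_vector_derivative D (Suc n) t) (at t))"
    by (intro exI[of _ "\<lambda>n t. D n t + E n t"]) auto
  moreover have "\<exists>a b. 0 < a \<and> b < 1 \<and> (\<forall>t. t \<notin> {a..b} \<longrightarrow> \<phi> t + \<psi> t = 0)"
  proof (rule exI[of _ "min a c"], rule exI[of _ "max b d"], intro conjI allI impI)
    fix t assume "t \<notin> {min a c..max b d}"
    then have "t \<notin> {a..b}" "t \<notin> {c..d}" by auto
    then have "\<phi> t = 0" "\<psi> t = 0" using ab(3) cd(3) by blast+
    then show "\<phi> t + \<psi> t = 0" by simp
  qed (use ab cd in auto)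
  ultimately show ?thesis by (simp add: test_function_def)
qed

lemma test_function_mult_ident:
  assumes "test_function \<phi>"
  shows "test_function (\<lambda>t. complex_of_real t * \<phi> t)"
proof -
  obtain D a b where D: "D 0 = \<phi>" "\<And>n t. (D n has_vector_derivative D (Suc n) t) (at t)"
    and ab: "0 < a" "b < 1" "\<And>t. t \<notin> {a..b} \<Longrightarrow> \<phi> t = 0"
    using assms unfolding test_function_def by blast
  \<comment> \<open>Leibniz formula for the \<open>n\<close>-th derivative; for \<open>n = 0\<close> the second term vanishes.\<close>
  define E where "E n t = complex_of_real t * D n t + of_nat n * D (n - 1) t" for n t
  have 1: "((\<lambda>t. complex_of_real t * D n t) has_vector_derivative
      complex_of_real t * D (Suc n) t + 1 * D n t) (at t)" for n t
    by (intro has_vector_derivative_mult D has_vector_derivative_of_real[of "\<lambda>t. t" 1, simplified])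
  have "(E n has_vector_derivative E (Suc n) t) (at t)" for n t
  proof (cases n)
    case 0
    with 1[of 0 t] show ?thesis by (simp add: E_def[abs_def])
  next
    case (Suc m)
    have "((\<lambda>t. complex_of_real t * D n t + of_nat n * D m t) has_vector_derivative
        (complex_of_real t * D (Suc n) t + 1 * D n t) + of_nat n * D (Suc m) t) (at t)"
      by (intro has_vector_derivative_add 1 has_vector_derivative_mult_right D)
    with Suc show ?thesis by (simp add: E_def[abs_def] algebra_simps)
  qed
  moreover have "E 0 = (\<lambda>t. complex_of_real t * \<phi> t)" by (simp add: E_def[abs_def] D(1))
  ultimately have "\<exists>D. D 0 = (\<lambda>t. complex_of_real t * \<phi> t) \<and>
      (\<forall>n t. (D n has_vector_derivative D (Suc n) t) (at t))" by blast
  moreover have "\<exists>a b. 0 < a \<and> b < 1 \<and> (\<forall>t. t \<notin> {a..b} \<longrightarrow> complex_of_real t * \<phi> t = 0)"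
    using ab by (intro exI[of _ a] exI[of _ b]) auto
  ultimately show ?thesis by (simp add: test_function_def)
qed

text \<open>Polynomials are dense in \<open>C\<^sup>1\<close> on the compact support of a test function, so that multiplication
  by polynomials can take the place of mollification.\<close>
lemma test_function_polynomial:
  assumes "real_polynomial_function p" "test_function \<phi>"
  shows "test_function (\<lambda>t. complex_of_real (p t) * \<phi> t)"
  using assms
proof (induction p arbitrary: \<phi>)
  case (linear f)
  have "f t = f 1 * t" for t using linear_scale[OF bounded_linear.linear[OF linear(1)], of t 1] by simp
  then have "complex_of_real (f t) = complex_of_real (f 1) * complex_of_real t" for t
    by (metis of_real_mult)
  then have "complex_of_real (f t) * \<phi> t = (complex_of_real (f 1) * complex_of_real t) * \<phi> t" for t
    by (rule arg_cong)
  then have "(\<lambda>t. complex_of_real (f t) * \<phi> t) =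
      (\<lambda>t. complex_of_real (f 1) * (complex_of_real t * \<phi> t))"
    unfolding mult.assoc by (rule ext)
  then show ?case using linear by (simp only: test_function_scale test_function_mult_ident)
next
  case (const c)
  then show ?case by (rule test_function_scale)
next
  case (add f g)
  then show ?case by (simp add: distrib_right test_function_add)
next
  case (mult f g)
  then show ?case by (simp add: mult.assoc)
qed

lemma test_function_continuous:
  assumes "test_function \<phi>"
  shows "continuous_on S \<phi>"
proof -
  obtain D where "D 0 = \<phi>" "\<And>n t. (D n has_vector_derivative D (Suc n) t) (at t)"
    using assms unfolding test_function_def by blast
  then have "(\<phi> has_vector_derivative D (Suc 0) t) (at t)" for t by metis
  then show ?thesis
    by (intro continuous_at_imp_continuous_on ballI) (rule has_vector_derivative_continuous)
qed

lemma test_function_C1_compact: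
  assumes "test_function \<phi>"
  obtains \<phi>' a b where "0 < a" "b < 1" "continuous_on UNIV \<phi>'"
    "\<And>t. (\<phi> has_vector_derivative \<phi>' t) (at t)" "\<And>t. t \<notin> {a..b} \<Longrightarrow> \<phi> t = 0 \<and> \<phi>' t = 0"
proof -
  obtain D a b where D: "D 0 = \<phi>" "\<And>n t. (D n has_vector_derivative D (Suc n) t) (at t)"
    and ab: "0 < a" "b < 1" "\<And>t. t \<notin> {a..b} \<Longrightarrow> \<phi> t = 0"
    using assms unfolding test_function_def by blast
  have cont: "continuous_on UNIV (D 1)"
    using D(2)[of 1] by (intro continuous_at_imp_continuous_on) (auto intro: has_vector_derivative_continuous)
  have "D 1 t = 0" if t: "t \<notin> {a..b}" for t
  proof -
    have "(\<phi> has_vector_derivative D 1 t) (at t)" using D(2)[of 0 t] by (simp add: D(1))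
    moreover have "open (- {a..b})" by (intro open_Compl closed_atLeastAtMost)
    ultimately have "((\<lambda>_. 0) has_vector_derivative D 1 t) (at t)"
      by (rule has_vector_derivative_transform_within_open) (use t ab(3) in blast)+
    from vector_derivative_unique_at[OF this has_vector_derivative_const] show ?thesis .
  qed
  with D(2)[of 0] ab cont show ?thesis by (intro that[of a b "D 1"]) (auto simp: D(1))
qed


section \<open>The minimal operator\<close>

lemma op_apply_eq:
  assumes "single_valued T" "(x, y) \<in> T"
  shows "op_apply T x = y"
  unfolding op_apply_def using assms by (blast intro: the_equality dest: single_valuedD)

lemma op_apply_mem:
  assumes "single_valued T" "x \<in> Domain T"
  shows "(x, op_apply T x) \<in> T"
  using assms op_apply_eq by fastforce

lemma linear_op_sum:
  assumes T: "linear_op whole_space T" and f: "\<And>k. k < (n::nat) \<Longrightarrow> f k \<in> Domain T"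
  shows "((\<Sum>k<n. c k *\<^sub>C f k), (\<Sum>k<n. c k *\<^sub>C op_apply T (f k))) \<in> T"
  using f
proof (induction n)
  case 0
  obtain x y where "(x, y) \<in> T" using T by (auto simp: linear_op_def)
  then have "(0 *\<^sub>C x, 0 *\<^sub>C y) \<in> T" using T by (simp add: linear_op_def whole_space_def)
  then show ?case by (simp add: scaleC.zero_left)
next
  case (Suc n)
  have "(f n, op_apply T (f n)) \<in> T" using T Suc.prems by (intro op_apply_mem) (auto simp: linear_op_def)
  then have "(c n *\<^sub>C f n, c n *\<^sub>C op_apply T (f n)) \<in> T"
    using T by (simp add: linear_op_def whole_space_def)
  with Suc show ?case using T by (simp add: linear_op_def whole_space_def)
qed

lemma elementary_functionsE:
  assumes "u \<in> elementary_functions D"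
  obtains \<phi> f and n :: nat where "u = (\<lambda>t. \<Sum>k<n. \<phi> k t *\<^sub>C f k)"
    "\<And>k. k < n \<Longrightarrow> test_function (\<phi> k)" "\<And>k. k < n \<Longrightarrow> f k \<in> D"
  using assms unfolding elementary_functions_def mem_Collect_eq
  by (elim exE conjE) (rule that, auto)

lemma elementary_C1_compact:
  assumes "u \<in> elementary_functions D"
  obtains a b u' where "0 < a" "a \<le> b" "b < 1" "continuous_on UNIV u'"
    "\<And>t. (u has_vector_derivative u' t) (at t)" "\<And>t. t \<notin> {a..b} \<Longrightarrow> u t = 0 \<and> u' t = 0"
proof -
  obtain n :: nat and \<phi> f where u: "u = (\<lambda>t. \<Sum>k<n. \<phi> k t *\<^sub>C f k)" and \<phi>: "\<And>k. k < n \<Longrightarrow> test_function (\<phi> k)"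
    by (rule elementary_functionsE[OF assms]) (rule that)
  have "\<exists>u' a b. 0 < a \<and> a \<le> b \<and> b < 1 \<and> continuous_on UNIV u' \<and>
      (\<forall>t. ((\<lambda>t. \<Sum>k<m. \<phi> k t *\<^sub>C f k) has_vector_derivative u' t) (at t)) \<and>
      (\<forall>t. t \<notin> {a..b} \<longrightarrow> (\<Sum>k<m. \<phi> k t *\<^sub>C f k) = 0 \<and> u' t = 0)" if "m \<le> n" for m
    using that
  proof (induction m)
    case 0
    show ?case by (intro exI[of _ "\<lambda>_. 0"] exI[of _ "1/2"]) auto
  next
    case (Suc m)
    then obtain u' a b where ab: "0 < a" "a \<le> b" "b < 1" and u': "continuous_on UNIV u'"
      "\<And>t. ((\<lambda>t. \<Sum>k<m. \<phi> k t *\<^sub>C f k) has_vector_derivative u' t) (at t)"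
      "\<And>t. t \<notin> {a..b} \<Longrightarrow> (\<Sum>k<m. \<phi> k t *\<^sub>C f k) = 0 \<and> u' t = 0" by auto
    obtain \<phi>' c d where cd: "0 < c" "d < 1" and \<phi>': "continuous_on UNIV \<phi>'"
      "\<And>t. (\<phi> m has_vector_derivative \<phi>' t) (at t)" "\<And>t. t \<notin> {c..d} \<Longrightarrow> \<phi> m t = 0 \<and> \<phi>' t = 0"
      using test_function_C1_compact[OF \<phi>[of m]] Suc.prems by (metis Suc_le_lessD)
    have "((\<lambda>t. \<phi> m t *\<^sub>C f m) has_vector_derivative \<phi>' t *\<^sub>C f m) (at t)" for t
      using bounded_linear.has_vector_derivative[OF scaleC.bounded_linear_left \<phi>'(2)] .
    then have "((\<lambda>t. \<Sum>k<Suc m. \<phi> k t *\<^sub>C f k) has_vector_derivative u' t + \<phi>' t *\<^sub>C f m) (at t)" for t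
      using u'(2) by (simp add: has_vector_derivative_add)
    moreover have "continuous_on UNIV (\<lambda>t. u' t + \<phi>' t *\<^sub>C f m)"
      by (intro continuous_on_add u' scaleC.continuous_on \<phi>' continuous_on_const)
    moreover have "(\<Sum>k<Suc m. \<phi> k t *\<^sub>C f k) = 0 \<and> u' t + \<phi>' t *\<^sub>C f m = 0"
      if "t \<notin> {min a c..max b d}" for t
    proof -
      have "t \<notin> {a..b}" "t \<notin> {c..d}" using that by auto
      then show ?thesis using u'(3)[of t] \<phi>'(3)[of t] by (simp add: scaleC.zero_left)
    qed
    ultimately show ?case
      using ab cd by (intro exI[of _ "\<lambda>t. u' t + \<phi>' t *\<^sub>C f m"] exI[of _ "min a c"] exI[of _ "max b d"]) auto
  qed
  from this[OF order_refl] show ?thesis using that unfolding u by blast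
qed

text \<open>An elementary function and its image under the expression are continuous, with support in a
  compact subinterval of the open unit interval: the coefficient is evaluated only on finitely many
  fixed vectors of the domain, on each of which it depends continuously on \<open>t\<close>.\<close>
lemma elementary_diff_expr:
  assumes A: "\<And>t. t \<in> {0..1} \<Longrightarrow> linear_op whole_space (A t)" "\<And>t. t \<in> {0..1} \<Longrightarrow> Domain (A t) = D"
    and cont: "\<And>f. f \<in> D \<Longrightarrow> continuous_on {0..1} (\<lambda>t. op_apply (A t) f)"
    and u: "u \<in> elementary_functions D"
  obtains a b g u' where "0 < a" "a \<le> b" "b < 1" "continuous_on {0..1} u" "continuous_on {0..1} g"
    "\<And>t. (u has_vector_derivative u' t) (at t)" "\<And>t. t \<in> {0..1} \<Longrightarrow> u t \<in> D"
    "\<And>t. t \<in> {0..1} \<Longrightarrow> g t = u' t + op_apply (A t) (u t)"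
    "\<And>t. t \<in> {0<..<1} \<Longrightarrow> diff_expr A u t = g t"
    "\<And>t. t \<notin> {a..b} \<Longrightarrow> u t = 0 \<and> u' t = 0" "\<And>t. t \<in> {0..1} - {a..b} \<Longrightarrow> g t = 0"
proof -
  obtain u' a b where ab: "0 < a" "a \<le> b" "b < 1" and u'_cont: "continuous_on UNIV u'"
    and u': "\<And>t. (u has_vector_derivative u' t) (at t)" "\<And>t. t \<notin> {a..b} \<Longrightarrow> u t = 0 \<and> u' t = 0"
    by (rule elementary_C1_compact[OF u]) (rule that)
  obtain n :: nat and \<phi> f where u_eq: "u = (\<lambda>t. \<Sum>k<n. \<phi> k t *\<^sub>C f k)"
    and \<phi>: "\<And>k. k < n \<Longrightarrow> test_function (\<phi> k)" and f: "\<And>k. k < n \<Longrightarrow> f k \<in> D"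
    by (rule elementary_functionsE[OF u]) (rule that)
  have mem: "(u t, \<Sum>k<n. \<phi> k t *\<^sub>C op_apply (A t) (f k)) \<in> A t" if "t \<in> {0..1}" for t
    unfolding u_eq using that f by (intro linear_op_sum A) (auto simp: A)
  then have apply_eq: "op_apply (A t) (u t) = (\<Sum>k<n. \<phi> k t *\<^sub>C op_apply (A t) (f k))" if "t \<in> {0..1}" for t
    using that A(1) by (intro op_apply_eq) (auto simp: linear_op_def)
  have "continuous_on {0..1} (\<phi> k)" if "k < n" for k
    using \<phi>[OF that] by (rule test_function_continuous)
  then have "continuous_on {0..1} (\<lambda>t. u' t + (\<Sum>k<n. \<phi> k t *\<^sub>C op_apply (A t) (f k)))"
    using f cont by (intro continuous_on_add continuous_on_sum scaleC.continuous_on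
        continuous_on_subset[OF u'_cont]) auto
  then have g: "continuous_on {0..1} (\<lambda>t. u' t + op_apply (A t) (u t))"
    by (rule continuous_on_eq) (simp add: apply_eq)
  have "op_apply (A t) (u t) = 0" if "t \<in> {0..1} - {a..b}" for t
  proof -
    have t: "t \<in> {0..1}" "t \<notin> {a..b}" using that by blast+
    have "(0 *\<^sub>C u t, 0 *\<^sub>C (\<Sum>k<n. \<phi> k t *\<^sub>C op_apply (A t) (f k))) \<in> A t"
      using mem[OF t(1)] A(1)[OF t(1)] by (simp add: linear_op_def whole_space_def)
    moreover have "u t = 0" using u'(2)[OF t(2)] by blast
    ultimately have "(u t, 0) \<in> A t" by (simp add: scaleC.zero_left)
    then show ?thesis using A(1)[OF t(1)] by (intro op_apply_eq) (simp add: linear_op_def)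
  qed
  moreover have "u t \<in> D" if "t \<in> {0..1}" for t using mem[OF that] A(2)[OF that] by blast
  moreover have "continuous_on {0..1} u"
    using u'(1) by (intro continuous_at_imp_continuous_on) (auto intro: has_vector_derivative_continuous)
  ultimately show ?thesis
    using ab u' g by (intro that[of a b "\<lambda>t. u' t + op_apply (A t) (u t)" u'])
      (auto simp: diff_expr_def vector_derivative_at)
qed

lemma elementary_polynomial_mult:
  assumes p: "real_polynomial_function p" and u: "u \<in> elementary_functions D"
  shows "(\<lambda>t. p t *\<^sub>R u t) \<in> elementary_functions D"
proof -
  obtain n :: nat and \<phi> f where u_eq: "u = (\<lambda>t. \<Sum>k<n. \<phi> k t *\<^sub>C f k)"
    and \<phi>: "\<And>k. k < n \<Longrightarrow> test_function (\<phi> k)" "\<And>k. k < n \<Longrightarrow> f k \<in> D"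
    by (rule elementary_functionsE[OF u]) (rule that)
  have "(\<lambda>t. p t *\<^sub>R u t) = (\<lambda>t. \<Sum>k<n. (complex_of_real (p t) * \<phi> k t) *\<^sub>C f k)"
    by (simp add: u_eq scaleR_conv_scaleC scaleC.sum_right scaleC_scaleC)
  moreover have "\<forall>k<n. test_function (\<lambda>t. complex_of_real (p t) * \<phi> k t) \<and> f k \<in> D"
    using \<phi> test_function_polynomial[OF p] by blast
  ultimately show ?thesis
    unfolding elementary_functions_def mem_Collect_eq
    by (intro exI[of _ n] exI[of _ "\<lambda>k t. complex_of_real (p t) * \<phi> k t"] exI[of _ f] conjI)
qed

lemma weight_C2:
  assumes C2: "C2_on_unit \<omega>" and nonneg: "\<And>t. t \<in> {0..1} \<Longrightarrow> 0 \<le> \<omega> t"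
    and null: "negligible {t \<in> {0..1}. \<omega> t = 0}"
  shows "weight \<omega>"
  unfolding weight_def
proof
  obtain \<omega>' where "\<And>t. t \<in> {0..1} \<Longrightarrow> (\<omega> has_real_derivative \<omega>' t) (at t within {0..1})"
    using C2_on_unit_derivatives[OF C2] by metis
  then have "continuous_on {0..1} \<omega>" by (rule DERIV_continuous_on)
  then have "continuous_on {0<..<1} \<omega>" by (rule continuous_on_subset) auto
  then show "\<omega> \<in> borel_measurable unit_lebesgue"
    by (rule continuous_imp_measurable_on_sets_lebesgue) simp
  have "AE t in lebesgue. t \<notin> {t \<in> {0..1}. \<omega> t = 0}"
    using null by (intro AE_not_in) (simp add: negligible_iff_null_sets)
  then have "AE t in lebesgue. t \<in> {0<..<1} \<longrightarrow> 0 < \<omega> t"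
  proof eventually_elim
    case (elim t)
    with nonneg[of t] show ?case by (auto simp: less_le)
  qed
  then show "AE t in unit_lebesgue. 0 < \<omega> t"
    by (simp add: AE_restrict_space_iff)
qed

lemma log_drift_measurable:
  assumes C2: "C2_on_unit \<omega>"
  shows "log_drift \<omega> \<in> borel_measurable unit_lebesgue"
proof -
  obtain \<omega>' \<omega>'' where \<omega>:
    "\<And>t. t \<in> {0..1} \<Longrightarrow> (\<omega> has_real_derivative \<omega>' t) (at t within {0..1})"
    "\<And>t. t \<in> {0..1} \<Longrightarrow> (\<omega>' has_real_derivative \<omega>'' t) (at t within {0..1})"
    "\<And>t. t \<in> {0<..<1} \<Longrightarrow> deriv \<omega> t = \<omega>' t"
    using C2_on_unit_derivatives[OF C2] by metis
  have "continuous_on {0..1} \<omega>" "continuous_on {0..1} \<omega>'"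
    using DERIV_continuous_on[OF \<omega>(1)] DERIV_continuous_on[OF \<omega>(2)] by auto
  then have "continuous_on {0<..<1} \<omega>" "continuous_on {0<..<1} \<omega>'"
    by (auto intro: continuous_on_subset)
  then have [measurable]: "\<omega> \<in> borel_measurable unit_lebesgue" "\<omega>' \<in> borel_measurable unit_lebesgue"
    by (auto intro: continuous_imp_measurable_on_sets_lebesgue)
  have "(\<lambda>t. \<omega>' t / (2 * \<omega> t)) \<in> borel_measurable unit_lebesgue" by measurable
  then show ?thesis
    by (rule measurable_cong[THEN iffD1, rotated]) (simp add: log_drift_def \<omega>(3))
qed

lemma continuous_unit_measurable:
  fixes u :: "real \<Rightarrow> 'a::topological_space"
  assumes "continuous_on {0..1} u"
  shows "u \<in> borel_measurable unit_lebesgue"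
  by (rule continuous_imp_measurable_on_sets_lebesgue[OF continuous_on_subset[OF assms]]) auto

lemma continuous_unit_bounded:
  fixes u :: "real \<Rightarrow> 'a::real_normed_vector"
  assumes "continuous_on {0..1} u"
  obtains B where "0 \<le> B" "\<And>t. t \<in> {0..1} \<Longrightarrow> norm (u t) \<le> B"
proof -
  obtain B where "\<forall>t\<in>{0..1}. norm (u t) \<le> B"
    using compact_imp_bounded[OF compact_continuous_image[OF assms compact_Icc]]
    unfolding bounded_iff by auto
  then show ?thesis using that[of "\<bar>B\<bar>"] by force
qed

lemma C2_bounded:
  fixes \<omega> :: "real \<Rightarrow> real"
  assumes C2: "C2_on_unit \<omega>"
  obtains B where "0 \<le> B" "\<And>t. t \<in> {0..1} \<Longrightarrow> \<omega> t \<le> B"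
proof -
  obtain \<omega>' where "\<And>t. t \<in> {0..1} \<Longrightarrow> (\<omega> has_real_derivative \<omega>' t) (at t within {0..1})"
    using C2_on_unit_derivatives[OF C2] by metis
  then have "continuous_on {0..1} \<omega>" by (rule DERIV_continuous_on)
  then obtain B where "0 \<le> B" "\<And>t. t \<in> {0..1} \<Longrightarrow> norm (\<omega> t) \<le> B"
    using continuous_unit_bounded by blast
  then show ?thesis using that[of B] by (simp add: abs_le_iff)
qed

lemma continuous_in_weighted_L2:
  fixes u :: "real \<Rightarrow> 'h::separable_chilbert"
  assumes C2: "C2_on_unit \<omega>" and w: "weight \<omega>" and u: "continuous_on {0..1} u"
  shows "ae_class u \<in> hcarrier (weighted_L2 \<omega>)"
proof -
  obtain B where B: "0 \<le> B" "\<And>t. t \<in> {0..1} \<Longrightarrow> \<omega> t \<le> B" using C2_bounded[OF C2] by blast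
  obtain R where R: "0 \<le> R" "\<And>t. t \<in> {0..1} \<Longrightarrow> norm (u t) \<le> R" using continuous_unit_bounded[OF u] by blast
  have pos: "AE t in unit_lebesgue. 0 < \<omega> t" using w by (simp add: weight_def)
  have "AE t in unit_lebesgue. \<bar>(norm (u t))\<^sup>2 * \<omega> t\<bar> \<le> R\<^sup>2 * B"
    using pos AE_space
  proof eventually_elim
    case (elim t)
    then have "(norm (u t))\<^sup>2 * \<omega> t \<le> R\<^sup>2 * B"
      using B R by (intro mult_mono power_mono) auto
    with elim show ?case by simp
  qed
  then have "square_integrable \<omega> u"
    using w continuous_unit_measurable[OF u] by (intro square_integrable_bounded) (auto simp: weight_def)
  then show ?thesis by (auto simp: hcarrier_weighted_L2)
qed

text \<open>With \<open>s = \<surd>(\<beta> / \<alpha>)\<close> and \<open>\<kappa>\<close> the difference of the logarithmic drifts, \<open>s' = s \<kappa>\<close>. The product rule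
  then turns \<open>u' + A u + \<kappa> u\<close>, multiplied by \<open>s\<close>, into the expression with coefficient \<open>A\<close> applied
  to \<open>s u\<close>. Since \<open>s u\<close> need not be elementary, it is approximated by \<open>P n u\<close> with the polynomials
  \<open>P n\<close> above: the expression applied to \<open>P n u\<close> is \<open>P' n u + P n g\<close> (with \<open>g\<close> the expression
  applied to \<open>u\<close>), which is bounded and converges almost everywhere. The limit is therefore bounded
  too, which is also why \<open>v\<close> is square integrable although \<open>\<kappa>\<close> is singular at zeros of \<open>\<beta>\<close>.\<close>
lemma weight_map_elementary:
  fixes A :: "real \<Rightarrow> 'h::separable_chilbert operator" and u v :: "real \<Rightarrow> 'h"
  assumes C2: "C2_on_unit \<alpha>" "C2_on_unit \<beta>" and w: "weight \<alpha>" "weight \<beta>"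
    and \<alpha>_pos: "\<And>t. t \<in> {0<..<1} \<Longrightarrow> 0 < \<alpha> t" and \<beta>_nonneg: "\<And>t. t \<in> {0..1} \<Longrightarrow> 0 \<le> \<beta> t"
    and A: "\<And>t. t \<in> {0..1} \<Longrightarrow> linear_op whole_space (A t)" "\<And>t. t \<in> {0..1} \<Longrightarrow> Domain (A t) = D"
    and cont: "\<And>f. f \<in> D \<Longrightarrow> continuous_on {0..1} (\<lambda>t. op_apply (A t) f)"
    and u: "u \<in> elementary_functions D"
    and v: "AE t in unit_lebesgue. v t = diff_expr A u t + (log_drift \<beta> t - log_drift \<alpha> t) *\<^sub>R u t"
  shows "ae_class v \<in> hcarrier (weighted_L2 \<beta>)"
    and "(weight_map \<beta> \<alpha> (ae_class u), weight_map \<beta> \<alpha> (ae_class v)) \<in> minimal_op \<alpha> D A"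
proof -
  obtain u' g a b where ab: "0 < a" "a \<le> b" "b < 1"
    and cu: "continuous_on {0..1} u" and cg: "continuous_on {0..1} g"
    and u': "\<And>t. (u has_vector_derivative u' t) (at t)" and uD: "\<And>t. t \<in> {0..1} \<Longrightarrow> u t \<in> D"
    and g: "\<And>t. t \<in> {0..1} \<Longrightarrow> g t = u' t + op_apply (A t) (u t)"
    and gu: "\<And>t. t \<in> {0<..<1} \<Longrightarrow> diff_expr A u t = g t"
    and supp: "\<And>t. t \<notin> {a..b} \<Longrightarrow> u t = 0 \<and> u' t = 0" "\<And>t. t \<in> {0..1} - {a..b} \<Longrightarrow> g t = 0"
    by (rule elementary_diff_expr[OF _ _ _ u]) (erule A(1), erule A(2), erule cont, rule that)
  define \<kappa> where "\<kappa> t = log_drift \<beta> t - log_drift \<alpha> t" for t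
  define s where "s t = sqrt (\<beta> t / \<alpha> t)" for t
  define v0 where "v0 t = g t + \<kappa> t *\<^sub>R u t" for t
  have [measurable]: "\<alpha> \<in> borel_measurable unit_lebesgue" "\<beta> \<in> borel_measurable unit_lebesgue"
    using w by (auto simp: weight_def)
  note [measurable] = continuous_unit_measurable[OF cu] continuous_unit_measurable[OF cg]
    log_drift_measurable[OF C2(1)] log_drift_measurable[OF C2(2)]
  have [measurable]: "\<kappa> \<in> borel_measurable unit_lebesgue" unfolding \<kappa>_def by measurable
  have v0_meas [measurable]: "v0 \<in> borel_measurable unit_lebesgue" unfolding v0_def by measurable
  have s_meas [measurable]: "s \<in> borel_measurable unit_lebesgue" unfolding s_def by measurable
  have "AE t in unit_lebesgue. v t = v0 t"
    using v AE_space by eventually_elim (simp add: v0_def \<kappa>_def gu)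
  then have vv0: "ae_class v = ae_class v0" by (rule ae_class_cong)
  obtain P P' M where P: "\<And>n. real_polynomial_function (P n)"
    "\<And>n t. (P n has_real_derivative P' n t) (at t)"
    "\<And>n t. t \<in> {a..b} \<Longrightarrow> \<bar>P n t\<bar> \<le> M" "\<And>n t. t \<in> {a..b} \<Longrightarrow> \<bar>P' n t\<bar> \<le> M"
    and P_lim: "\<And>t. t \<in> {a..b} \<Longrightarrow> (\<lambda>n. P n t) \<longlonglongrightarrow> s t"
    "\<And>t. t \<in> {a..b} \<Longrightarrow> 0 < \<beta> t \<Longrightarrow> (\<lambda>n. P' n t) \<longlonglongrightarrow> s t * \<kappa> t"
    by (rule sqrt_quotient_polynomial_approx[OF C2 _ _ ab, folded s_def \<kappa>_def])
      (erule \<alpha>_pos, erule \<beta>_nonneg, rule that)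
  have M: "0 \<le> M" using P(3)[of a 0] ab(2) by (auto intro: order_trans[OF abs_ge_zero])
  obtain Bu where Bu: "0 \<le> Bu" "\<And>t. t \<in> {0..1} \<Longrightarrow> norm (u t) \<le> Bu" using continuous_unit_bounded[OF cu] by blast
  obtain Bg where Bg: "0 \<le> Bg" "\<And>t. t \<in> {0..1} \<Longrightarrow> norm (g t) \<le> Bg" using continuous_unit_bounded[OF cg] by blast
  obtain B where B: "0 \<le> B" "\<And>t. t \<in> {0..1} \<Longrightarrow> \<alpha> t \<le> B" using C2_bounded[OF C2(1)] by blast
  define U where "U n t = P n t *\<^sub>R u t" for n t
  define V where "V n t = P' n t *\<^sub>R u t + P n t *\<^sub>R g t" for n t
  define R where "R = M * Bu + M * Bg"
  have pos: "AE t in unit_lebesgue. 0 < \<alpha> t" "AE t in unit_lebesgue. 0 < \<beta> t"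
    using w by (auto simp: weight_def)
  have U_elem: "U n \<in> elementary_functions D" for n
    unfolding U_def by (rule elementary_polynomial_mult[OF P(1) u])
  have UV: "diff_expr A (U n) t = V n t" if t: "t \<in> {0<..<1}" for n t
  proof -
    have t01: "t \<in> {0..1}" using t by simp
    have "(U n has_vector_derivative P n t *\<^sub>R u' t + P' n t *\<^sub>R u t) (at t)"
      unfolding U_def by (intro has_vector_derivative_scaleR P(2) u')
    moreover have "op_apply (A t) (U n t) = P n t *\<^sub>R op_apply (A t) (u t)"
    proof (rule op_apply_eq)
      have "(u t, op_apply (A t) (u t)) \<in> A t"
        using A(1)[OF t01] A(2)[OF t01] uD[OF t01] by (intro op_apply_mem) (auto simp: linear_op_def)
      then show "(U n t, P n t *\<^sub>R op_apply (A t) (u t)) \<in> A t"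
        using A(1)[OF t01] by (simp add: linear_op_def whole_space_def U_def scaleR_conv_scaleC)
    qed (use A(1)[OF t01] in \<open>simp add: linear_op_def\<close>)
    ultimately show ?thesis
      by (simp add: diff_expr_def vector_derivative_at V_def g[OF t01] scaleR_add_right)
  qed
  have V_class: "ae_class (diff_expr A (U n)) = ae_class (V n)" for n
    by (rule ae_class_cong) (use AE_space in eventually_elim, simp add: UV)
  have P_meas [measurable]: "P n \<in> borel_measurable unit_lebesgue"
     "P' n \<in> borel_measurable unit_lebesgue" for n
  proof -
    have "continuous_on {0..1} (P n)"
      using P(2) by (meson DERIV_continuous_on has_field_derivative_at_within)
    then show "P n \<in> borel_measurable unit_lebesgue" by (rule continuous_unit_measurable)
    obtain q where q: "real_polynomial_function q" "\<And>t. (P n has_real_derivative q t) (at t)"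
      using has_real_derivative_polynomial_function[OF P(1)] by blast
    then have "P' n = q" using P(2) by (intro ext) (metis DERIV_unique)
    moreover obtain q' where "\<And>t. (q has_real_derivative q' t) (at t)"
      using has_real_derivative_polynomial_function[OF q(1)] by blast
    then have "continuous_on {0..1} q"
      by (meson DERIV_continuous_on has_field_derivative_at_within)
    ultimately show "P' n \<in> borel_measurable unit_lebesgue"
      by (simp add: continuous_unit_measurable)
  qed
  have U_meas [measurable]: "U n \<in> borel_measurable unit_lebesgue" for n unfolding U_def by measurable
  have V_meas [measurable]: "V n \<in> borel_measurable unit_lebesgue" for n unfolding V_def by measurable
  have U_lim: "(\<lambda>n. U n t) \<longlonglongrightarrow> s t *\<^sub>R u t" for t
    unfolding U_def using P_lim(1)[of t] supp(1)[of t]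
    by (cases "t \<in> {a..b}") (auto intro!: tendsto_intros)
  have V_lim: "(\<lambda>n. V n t) \<longlonglongrightarrow> s t *\<^sub>R v0 t" if "t \<in> {0<..<1}" "0 < \<beta> t" for t
  proof (cases "t \<in> {a..b}")
    case True
    have "(\<lambda>n. V n t) \<longlonglongrightarrow> (s t * \<kappa> t) *\<^sub>R u t + s t *\<^sub>R g t"
      unfolding V_def by (intro tendsto_intros P_lim True that)
    then show ?thesis by (simp add: v0_def scaleR_add_right add.commute)
  qed (use that supp in \<open>simp add: V_def v0_def\<close>)
  have U_bound: "norm (U n t) \<le> R" if "t \<in> {0<..<1}" for n t
  proof (cases "t \<in> {a..b}")
    case True
    have "norm (U n t) \<le> M * Bu" unfolding U_def
      using P(3)[OF True] Bu(2)[of t] that M by (auto intro!: mult_mono)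
    then show ?thesis using M Bg by (simp add: R_def add_increasing2)
  qed (use M Bu Bg supp in \<open>simp add: U_def R_def\<close>)
  have V_bound: "norm (V n t) \<le> R" if "t \<in> {0<..<1}" for n t
  proof (cases "t \<in> {a..b}")
    case True
    have "norm (P' n t *\<^sub>R u t) \<le> M * Bu" "norm (P n t *\<^sub>R g t) \<le> M * Bg"
      using P(3,4)[OF True] Bu(2)[of t] Bg(2)[of t] that M by (auto intro!: mult_mono)
    then show ?thesis unfolding V_def R_def by (meson add_mono norm_triangle_ineq order_trans)
  qed (use that M Bu Bg supp in \<open>simp add: V_def R_def\<close>)
  have su_bound: "norm (s t *\<^sub>R u t) \<le> R" if "t \<in> {0<..<1}" for t
    using tendsto_norm[OF U_lim] by (rule LIMSEQ_le_const2) (use U_bound that in auto)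
  have sv_bound: "norm (s t *\<^sub>R v0 t) \<le> R" if "t \<in> {0<..<1}" "0 < \<beta> t" for t
    using tendsto_norm[OF V_lim[OF that]] by (rule LIMSEQ_le_const2) (use V_bound that in auto)
  have dist_bound: "(norm (x - y))\<^sup>2 * \<alpha> t \<le> (2 * R)\<^sup>2 * B"
    if "norm x \<le> R" "norm y \<le> R" "t \<in> {0<..<1}" "0 < \<alpha> t" for x y :: 'h and t
  proof -
    have "norm (x - y) \<le> 2 * R" using norm_triangle_ineq4[of x y] that by linarith
    then show ?thesis using that B by (intro mult_mono power_mono) auto
  qed
  have convU: "hconverges (weighted_L2 \<alpha>) (\<lambda>n. ae_class (U n)) (ae_class (\<lambda>t. s t *\<^sub>R u t))"
  proof (rule hconverges_dominated[OF w(1)]; (measurable)?)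
    show "AE t in unit_lebesgue. (\<lambda>n. U n t) \<longlonglongrightarrow> s t *\<^sub>R u t" by (simp add: U_lim)
    show "AE t in unit_lebesgue. (norm (U n t - s t *\<^sub>R u t))\<^sup>2 * \<alpha> t \<le> (2 * R)\<^sup>2 * B" for n
      using pos AE_space by eventually_elim (rule dist_bound[OF U_bound su_bound], simp_all)
  qed
  have convV: "hconverges (weighted_L2 \<alpha>) (\<lambda>n. ae_class (V n)) (ae_class (\<lambda>t. s t *\<^sub>R v0 t))"
  proof (rule hconverges_dominated[OF w(1)]; (measurable)?)
    show "AE t in unit_lebesgue. (\<lambda>n. V n t) \<longlonglongrightarrow> s t *\<^sub>R v0 t"
      using pos AE_space by eventually_elim (auto intro!: V_lim)
    show "AE t in unit_lebesgue. (norm (V n t - s t *\<^sub>R v0 t))\<^sup>2 * \<alpha> t \<le> (2 * R)\<^sup>2 * B" for n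
      using pos AE_space by eventually_elim (rule dist_bound[OF V_bound sv_bound], simp_all)
  qed
  have "square_integrable \<beta> v0"
  proof (rule square_integrable_bounded; (measurable)?)
    show "AE t in unit_lebesgue. \<bar>(norm (v0 t))\<^sup>2 * \<beta> t\<bar> \<le> R\<^sup>2 * B"
      using pos AE_space
    proof eventually_elim
      case (elim t)
      then have "(norm (v0 t))\<^sup>2 * \<beta> t = (norm (s t *\<^sub>R v0 t))\<^sup>2 * \<alpha> t"
        by (simp add: s_def power_mult_distrib)
      also have "\<dots> \<le> R\<^sup>2 * B"
        using elim sv_bound[of t] B by (intro mult_mono power_mono) auto
      finally show ?case using elim by simp
    qed
  qed
  then show v_carrier: "ae_class v \<in> hcarrier (weighted_L2 \<beta>)"
    unfolding vv0 by (auto simp: hcarrier_weighted_L2)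
  interpret hilb_unitary "weighted_L2 \<beta>" "weighted_L2 \<alpha>" "weight_map \<beta> \<alpha> :: (real \<Rightarrow> 'h) set \<Rightarrow> _"
    by (rule weight_map_unitary[OF w(2,1)])
  have carrier: "weight_map \<beta> \<alpha> (ae_class u) \<in> hcarrier (weighted_L2 \<alpha>)"
    "weight_map \<beta> \<alpha> (ae_class v) \<in> hcarrier (weighted_L2 \<alpha>)"
    by (intro map_carrier continuous_in_weighted_L2[OF C2(2) w(2) cu] v_carrier)+
  have "weight_map \<beta> \<alpha> (ae_class u) = ae_class (\<lambda>t. s t *\<^sub>R u t)"
    "weight_map \<beta> \<alpha> (ae_class v) = ae_class (\<lambda>t. s t *\<^sub>R v0 t)"
    by (simp_all add: vv0 weight_map_ae_class s_def)
  moreover have "(ae_class (U n), ae_class (V n)) \<in>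
      {(ae_class u, ae_class (diff_expr A u)) | u. u \<in> elementary_functions D}" for n
    using U_elem[of n] V_class[of n] by auto
  ultimately show "(weight_map \<beta> \<alpha> (ae_class u), weight_map \<beta> \<alpha> (ae_class v)) \<in> minimal_op \<alpha> D A"
    using carrier convU convV unfolding minimal_op_def op_closure_def mem_Collect_eq prod.case
    by (intro conjI exI[of _ "\<lambda>n. ae_class (U n)"] exI[of _ "\<lambda>n. ae_class (V n)"]) auto
qed

section \<open>Transport between weighted spaces\<close>

text \<open>By isometry of the weight map, an approximating sequence of elementary functions in one weighted
  space is carried to a sequence in the minimal operator of the other, which is closed.\<close>
lemma minimal_op_transport:
  fixes A B :: "real \<Rightarrow> 'h::separable_chilbert operator"
  assumes C2: "C2_on_unit \<alpha>" "C2_on_unit \<beta>" and w: "weight \<alpha>" "weight \<beta>"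
    and \<alpha>_pos: "\<And>t. t \<in> {0<..<1} \<Longrightarrow> 0 < \<alpha> t" and \<beta>_nonneg: "\<And>t. t \<in> {0..1} \<Longrightarrow> 0 \<le> \<beta> t"
    and A: "\<And>t. t \<in> {0..1} \<Longrightarrow> linear_op whole_space (A t)" "\<And>t. t \<in> {0..1} \<Longrightarrow> Domain (A t) = D"
    and cont: "\<And>f. f \<in> D \<Longrightarrow> continuous_on {0..1} (\<lambda>t. op_apply (A t) f)"
    and B: "AE t in unit_lebesgue. \<forall>x\<in>D. op_apply (B t) x =
      op_apply (A t) x + (log_drift \<beta> t - log_drift \<alpha> t) *\<^sub>R x"
    and UV: "(U, V) \<in> minimal_op \<beta> D B"
  shows "(weight_map \<beta> \<alpha> U, weight_map \<beta> \<alpha> V) \<in> minimal_op \<alpha> D A"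
proof -
  define T where "T = {(ae_class u, ae_class (diff_expr A u)) | u. u \<in> elementary_functions D}"
  interpret hilb_unitary "weighted_L2 \<beta>" "weighted_L2 \<alpha>" "weight_map \<beta> \<alpha> :: (real \<Rightarrow> 'h) set \<Rightarrow> _"
    by (rule weight_map_unitary[OF w(2,1)])
  have carrier: "ae_class u \<in> hcarrier (weighted_L2 \<omega>)" "ae_class (diff_expr A u) \<in> hcarrier (weighted_L2 \<omega>)"
    "\<And>t. t \<in> {0..1} \<Longrightarrow> u t \<in> D"
    if u: "u \<in> elementary_functions D" and \<omega>: "C2_on_unit \<omega>" "weight \<omega>" for u \<omega>
  proof -
    obtain a b g u' where "0 < a" "a \<le> b" "b < 1" and cu: "continuous_on {0..1} u"
      and cg: "continuous_on {0..1} g" and "\<And>t. (u has_vector_derivative u' t) (at t)"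
      and uD: "\<And>t. t \<in> {0..1} \<Longrightarrow> u t \<in> D"
      and "\<And>t. t \<in> {0..1} \<Longrightarrow> g t = u' t + op_apply (A t) (u t)"
      and gu: "\<And>t. t \<in> {0<..<1} \<Longrightarrow> diff_expr A u t = g t"
      and "\<And>t. t \<notin> {a..b} \<Longrightarrow> u t = 0 \<and> u' t = 0" "\<And>t. t \<in> {0..1} - {a..b} \<Longrightarrow> g t = 0"
      by (rule elementary_diff_expr[OF _ _ _ u]) (erule A(1), erule A(2), erule cont, rule that)
    have "ae_class (diff_expr A u) = ae_class g"
      by (rule ae_class_cong) (use AE_space in eventually_elim, simp add: gu)
    then show "ae_class u \<in> hcarrier (weighted_L2 \<omega>)" "ae_class (diff_expr A u) \<in> hcarrier (weighted_L2 \<omega>)"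
      using continuous_in_weighted_L2[OF \<omega> cu] continuous_in_weighted_L2[OF \<omega> cg] by simp_all
    show "u t \<in> D" if "t \<in> {0..1}" for t using that by (rule uD)
  qed
  have elem: "ae_class (diff_expr B u) \<in> hcarrier (weighted_L2 \<beta>)"
    "(weight_map \<beta> \<alpha> (ae_class u), weight_map \<beta> \<alpha> (ae_class (diff_expr B u))) \<in> minimal_op \<alpha> D A"
    if u: "u \<in> elementary_functions D" for u
  proof -
    have "AE t in unit_lebesgue. diff_expr B u t =
        diff_expr A u t + (log_drift \<beta> t - log_drift \<alpha> t) *\<^sub>R u t"
      using B AE_space
    proof eventually_elim
      case (elim t)
      with carrier(3)[OF u C2(1) w(1), of t] show ?case by (simp add: diff_expr_def)
    qed
    note * = weight_map_elementary[OF C2 w \<alpha>_pos \<beta>_nonneg A cont u this]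
    show "ae_class (diff_expr B u) \<in> hcarrier (weighted_L2 \<beta>)" by (rule *(1))
    show "(weight_map \<beta> \<alpha> (ae_class u), weight_map \<beta> \<alpha> (ae_class (diff_expr B u))) \<in> minimal_op \<alpha> D A"
      by (rule *(2))
  qed
  obtain X Y where carr: "U \<in> hcarrier (weighted_L2 \<beta>)" "V \<in> hcarrier (weighted_L2 \<beta>)"
    and XY: "\<And>n. (X n, Y n) \<in> {(ae_class u, ae_class (diff_expr B u)) | u. u \<in> elementary_functions D}"
    and conv: "hconverges (weighted_L2 \<beta>) X U" "hconverges (weighted_L2 \<beta>) Y V"
    using UV unfolding minimal_op_def op_closure_def by blast
  have mem: "X n \<in> hcarrier (weighted_L2 \<beta>)" "Y n \<in> hcarrier (weighted_L2 \<beta>)"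
    "(weight_map \<beta> \<alpha> (X n), weight_map \<beta> \<alpha> (Y n)) \<in> minimal_op \<alpha> D A" for n
    using XY[of n] elem carrier(1)[OF _ C2(2) w(2)] by auto
  have "(weight_map \<beta> \<alpha> U, weight_map \<beta> \<alpha> V) \<in> op_closure (weighted_L2 \<alpha>) (minimal_op \<alpha> D A)"
    unfolding op_closure_def mem_Collect_eq prod.case
    using mem carr conv
    by (intro conjI exI[of _ "\<lambda>n. weight_map \<beta> \<alpha> (X n)"] exI[of _ "\<lambda>n. weight_map \<beta> \<alpha> (Y n)"])
      (simp_all add: map_carrier map_hconverges)
  moreover have "T \<subseteq> hcarrier (weighted_L2 \<alpha>) \<times> hcarrier (weighted_L2 \<alpha>)"
    unfolding T_def using carrier(1,2)[OF _ C2(1) w(1)] by blast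
  then have "op_closure (weighted_L2 \<alpha>) (op_closure (weighted_L2 \<alpha>) T) \<subseteq> op_closure (weighted_L2 \<alpha>) T"
    by (intro op_closure_closed weighted_L2_quasi_triangle w)
  ultimately show ?thesis unfolding minimal_op_def T_def by blast
qed

lemma op_add_scalar_op_iff:
  "(x, z) \<in> op_add whole_space (scalar_op whole_space (complex_of_real c)) T \<longleftrightarrow>
    (\<exists>y. (x, y) \<in> T \<and> z = c *\<^sub>R x + y)"
  by (auto simp: op_add_def scalar_op_def whole_space_def scaleC_of_real)

lemma op_add_i_scale_iff:
  "(x, z) \<in> op_add whole_space S (op_scale whole_space \<i> T) \<longleftrightarrow>
    (\<exists>r s. (x, r) \<in> S \<and> (x, s) \<in> T \<and> z = r + \<i> *\<^sub>C s)"
  by (auto simp: op_add_def op_scale_def whole_space_def)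

lemma dense_zero_imp_trivial:
  fixes T :: "'h::separable_chilbert operator"
  assumes "densely_defined whole_space T" "Domain T \<subseteq> {0}"
  shows "x = (0 :: 'h)"
proof -
  have x: "x \<in> hcarrier whole_space" by (simp add: whole_space_def)
  obtain X where X: "\<And>n. X n \<in> Domain T" "hconverges whole_space X x"
    using assms(1) x unfolding densely_defined_def by blast
  then have "X n = 0" for n using assms(2) by blast
  moreover have "norm ((-1) *\<^sub>C x) = norm x" by (simp add: norm_scaleC)
  ultimately have "(\<lambda>n::nat. norm x) \<longlonglongrightarrow> 0"
    using X(2) by (simp add: hconverges_def hnorm_whole_space) (simp add: hdiff_def whole_space_def)
  then show ?thesis by (simp add: LIMSEQ_const_iff)
qed

theorem theorem11:
  fixes \<alpha> \<beta> :: "real \<Rightarrow> real"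
    and D\<^sub>A :: "'h::separable_chilbert set"
    and A A\<^sub>r A\<^sub>i :: "real \<Rightarrow> 'h operator"
    and C :: "'h operator"
    and Lt :: "(real \<Rightarrow> 'h) set operator"
  assumes "C2_on_unit \<alpha>" and "C2_on_unit \<beta>"
    and "\<And>t. t \<in> {0..1} \<Longrightarrow> 0 \<le> \<alpha> t" and "\<And>t. t \<in> {0..1} \<Longrightarrow> 0 \<le> \<beta> t"
    and "negligible {t \<in> {0..1}. \<alpha> t = 0}" and "negligible {t \<in> {0..1}. \<beta> t = 0}"
    and "\<And>t. t \<in> {0..1} \<Longrightarrow> linear_op whole_space (A t)"
    and "\<And>t. t \<in> {0..1} \<Longrightarrow> densely_defined whole_space (A t)"
    and "\<And>t. t \<in> {0..1} \<Longrightarrow> closed_op whole_space (A t)"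
    and "\<And>t. t \<in> {0..1} \<Longrightarrow> Domain (A t) = D\<^sub>A"
    and "\<And>t. t \<in> {0..1} \<Longrightarrow> A t = op_add whole_space (A\<^sub>r t) (op_scale whole_space \<i> (A\<^sub>i t))"
    and "\<And>t. t \<in> {0..1} \<Longrightarrow> self_adjoint_op whole_space (A\<^sub>r t)"
    and "\<And>t. t \<in> {0..1} \<Longrightarrow> self_adjoint_op whole_space (A\<^sub>i t)"
    and "\<And>t. t \<in> {0..1} \<Longrightarrow> ops_commute (A\<^sub>r t) (A\<^sub>i t)"
    and "\<And>f. f \<in> D\<^sub>A \<Longrightarrow> C1_on_unit (\<lambda>t. op_apply (A\<^sub>r t) f)"
    and "\<And>f. f \<in> D\<^sub>A \<Longrightarrow> C1_on_unit (\<lambda>t. op_apply (A\<^sub>i t) f)"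
    and "AE t in unit_lebesgue. op_bounded_below whole_space (log_drift \<alpha> t) (A\<^sub>r t)"
    and "AE t in unit_lebesgue. A\<^sub>r t = drift_op \<alpha> C t"
    and "self_adjoint_op whole_space C" and "op_bounded_below whole_space 0 C" and "Domain C = D\<^sub>A"
    and "op_extension (weighted_L2 \<alpha>) (minimal_op \<alpha> D\<^sub>A A) Lt"
  defines "J\<^sub>0 \<equiv> minimal_op \<beta> D\<^sub>A
      (\<lambda>t. op_add whole_space (drift_op \<beta> C t) (op_scale whole_space \<i> (A\<^sub>i t)))"
    and "Jt \<equiv> transported_op \<alpha> \<beta> Lt"
  shows "op_extension (weighted_L2 \<beta>) J\<^sub>0 Jt \<and>
    (normal_op (weighted_L2 \<alpha>) Lt \<longleftrightarrow> normal_op (weighted_L2 \<beta>) Jt) \<and>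
    op_spectrum (weighted_L2 \<alpha>) Lt = op_spectrum (weighted_L2 \<beta>) Jt"
proof -
  note C2 = assms(1,2) and \<beta>_nonneg = assms(4) and A_lin = assms(7) and A_dom = assms(10)
    and A_eq = assms(11)
  have w: "weight \<alpha>" "weight \<beta>" using assms(1-6) by (auto intro: weight_C2)
  have Lt: "linear_op (weighted_L2 \<alpha>) Lt" "minimal_op \<alpha> D\<^sub>A A \<subseteq> Lt"
    using assms(22) by (auto simp: op_extension_def)
  have sub: "Lt \<subseteq> hcarrier (weighted_L2 \<alpha>) \<times> hcarrier (weighted_L2 \<alpha>)"
    using Lt(1) by (simp add: linear_op_def)
  interpret F: hilb_unitary "weighted_L2 \<alpha>" "weighted_L2 \<beta>" "weight_map \<alpha> \<beta> :: (real \<Rightarrow> 'h) set \<Rightarrow> _"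
    by (rule weight_map_unitary[OF w])
  interpret G: hilb_unitary "weighted_L2 \<beta>" "weighted_L2 \<alpha>" "weight_map \<beta> \<alpha> :: (real \<Rightarrow> 'h) set \<Rightarrow> _"
    by (rule weight_map_unitary[OF w(2,1)])
  have Jt: "Jt = F.op_image Lt"
  proof (intro set_eqI iffI)
    fix p assume "p \<in> Jt"
    then obtain U V where p: "p = (U, weight_map \<alpha> \<beta> V)" "U \<in> hcarrier (weighted_L2 \<beta>)"
        "(weight_map \<beta> \<alpha> U, V) \<in> Lt"
      unfolding Jt_def transported_op_def by blast
    have "weight_map \<alpha> \<beta> (weight_map \<beta> \<alpha> U) = U" by (rule weight_map_inverse[OF w(2,1) p(2)])
    then have "p = map_prod (weight_map \<alpha> \<beta>) (weight_map \<alpha> \<beta>) (weight_map \<beta> \<alpha> U, V)"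
      by (simp add: p(1))
    then show "p \<in> F.op_image Lt" unfolding F.op_image_def using p(3) by (rule image_eqI)
  next
    fix p assume "p \<in> F.op_image Lt"
    then obtain X V where p: "p = (weight_map \<alpha> \<beta> X, weight_map \<alpha> \<beta> V)" "(X, V) \<in> Lt"
        "X \<in> hcarrier (weighted_L2 \<alpha>)"
      using sub unfolding F.op_image_def by auto
    with weight_map_inverse[OF w p(3)] show "p \<in> Jt"
      unfolding Jt_def transported_op_def by (auto simp: F.map_carrier)
  qed
  have C: "single_valued C" using assms(19) by (simp add: self_adjoint_op_def linear_op_def)
  have Ar: "single_valued (A\<^sub>r t)" and Ai: "single_valued (A\<^sub>i t)" if "t \<in> {0..1}" for t
    using assms(12,13) that by (auto simp: self_adjoint_op_def linear_op_def)
  have A_apply: "(x, op_apply (A\<^sub>r t) x) \<in> A\<^sub>r t" "(x, op_apply (A\<^sub>i t) x) \<in> A\<^sub>i t"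
    "op_apply (A t) x = op_apply (A\<^sub>r t) x + \<i> *\<^sub>C op_apply (A\<^sub>i t) x"
    if t: "t \<in> {0..1}" and x: "x \<in> D\<^sub>A" for t x
  proof -
    obtain y where y: "(x, y) \<in> A t" using A_dom[OF t] x by blast
    then obtain r s where rs: "(x, r) \<in> A\<^sub>r t" "(x, s) \<in> A\<^sub>i t" "y = r + \<i> *\<^sub>C s"
      unfolding A_eq[OF t] op_add_i_scale_iff by blast
    have "op_apply (A\<^sub>r t) x = r" "op_apply (A\<^sub>i t) x = s" "op_apply (A t) x = y"
      using op_apply_eq[OF Ar[OF t] rs(1)] op_apply_eq[OF Ai[OF t] rs(2)] op_apply_eq[OF _ y]
        A_lin[OF t] by (auto simp: linear_op_def)
    with rs show "(x, op_apply (A\<^sub>r t) x) \<in> A\<^sub>r t" "(x, op_apply (A\<^sub>i t) x) \<in> A\<^sub>i t"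
      "op_apply (A t) x = op_apply (A\<^sub>r t) x + \<i> *\<^sub>C op_apply (A\<^sub>i t) x" by simp_all
  qed
  have C_apply: "(x, op_apply C x) \<in> C" if "x \<in> D\<^sub>A" for x
    using op_apply_mem[OF C] assms(21) that by blast
  have drift: "AE t in unit_lebesgue. \<forall>x\<in>D\<^sub>A. op_apply (A\<^sub>r t) x = log_drift \<alpha> t *\<^sub>R x + op_apply C x"
    using assms(18) AE_space
  proof eventually_elim
    case (elim t)
    then have t: "t \<in> {0..1}" by simp
    show ?case
    proof
      fix x assume x: "x \<in> D\<^sub>A"
      have "(x, log_drift \<alpha> t *\<^sub>R x + op_apply C x) \<in> A\<^sub>r t"
        using C_apply[OF x] unfolding elim(1) drift_op_def op_add_scalar_op_iff by blast
      then show "op_apply (A\<^sub>r t) x = log_drift \<alpha> t *\<^sub>R x + op_apply C x"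
        by (rule op_apply_eq[OF Ar[OF t]])
    qed
  qed
  have C1_cont: "continuous_on {0..1} h" if "C1_on_unit h" for h :: "real \<Rightarrow> 'h"
    using that unfolding C1_on_unit_def continuous_on_eq_continuous_within
    by (blast intro: has_vector_derivative_continuous)
  have A_cont: "continuous_on {0..1} (\<lambda>t. op_apply (A t) f)" if f: "f \<in> D\<^sub>A" for f
  proof -
    have "continuous_on {0..1} (\<lambda>t. op_apply (A\<^sub>r t) f + \<i> *\<^sub>C op_apply (A\<^sub>i t) f)"
      by (intro continuous_on_add scaleC.continuous_on continuous_on_const C1_cont assms(15,16) f)
    then show ?thesis by (rule continuous_on_eq) (simp add: A_apply(3) f)
  qed
  have B: "AE t in unit_lebesgue. \<forall>x\<in>D\<^sub>A.
      op_apply (op_add whole_space (drift_op \<beta> C t) (op_scale whole_space \<i> (A\<^sub>i t))) x =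
      op_apply (A t) x + (log_drift \<beta> t - log_drift \<alpha> t) *\<^sub>R x"
    using drift AE_space
  proof eventually_elim
    case (elim t)
    then have t: "t \<in> {0..1}" by simp
    show ?case
    proof
      fix x assume x: "x \<in> D\<^sub>A"
      let ?B = "op_add whole_space (drift_op \<beta> C t) (op_scale whole_space \<i> (A\<^sub>i t))"
      have "(x, log_drift \<beta> t *\<^sub>R x + op_apply C x + \<i> *\<^sub>C op_apply (A\<^sub>i t) x) \<in> ?B"
        using C_apply[OF x] A_apply(2)[OF t x]
        unfolding op_add_i_scale_iff drift_op_def op_add_scalar_op_iff by blast
      moreover have "single_valued ?B"
        using single_valuedD[OF C] single_valuedD[OF Ai[OF t]]
        by (intro single_valuedI) (unfold op_add_i_scale_iff drift_op_def op_add_scalar_op_iff, blast)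
      ultimately have "op_apply ?B x = log_drift \<beta> t *\<^sub>R x + op_apply C x + \<i> *\<^sub>C op_apply (A\<^sub>i t) x"
        by (intro op_apply_eq)
      then show "op_apply ?B x = op_apply (A t) x + (log_drift \<beta> t - log_drift \<alpha> t) *\<^sub>R x"
        using elim(1) x by (simp add: A_apply(3)[OF t x] scaleR_diff_left)
    qed
  qed
  have "J\<^sub>0 \<subseteq> Jt"
  proof (cases "D\<^sub>A \<subseteq> {0}")
    \<comment> \<open>The drift of \<open>\<alpha>\<close> is seen only through its action on a nonzero vector. Without one, density
      of the domain makes \<open>H\<close> trivial, and both operators consist of the pair of zeros.\<close>
    case True
    have triv: "x = 0" for x :: 'h
      using dense_zero_imp_trivial[OF assms(8)[of 0]] True A_dom[of 0] by simp
    have all: "u = v" for u v :: "real \<Rightarrow> 'h" by (rule ext) (metis triv)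
    have cls: "U = ae_class (\<lambda>_. 0)" if "U \<in> hcarrier (weighted_L2 \<omega>)" for U :: "(real \<Rightarrow> 'h) set" and \<omega>
      using that unfolding hcarrier_weighted_L2 by (metis all)
    obtain X Y where XY: "(X, Y) \<in> Jt"
      using F.linear_op_image[OF Lt(1)] unfolding Jt linear_op_def by (metis surj_pair ex_in_conv)
    then have "X = ae_class (\<lambda>_. 0)" "Y = ae_class (\<lambda>_. 0)"
      using F.linear_op_image[OF Lt(1)] cls[of _ \<beta>] unfolding Jt linear_op_def by blast+
    moreover have "U = ae_class (\<lambda>_. 0) \<and> V = ae_class (\<lambda>_. 0)" if "(U, V) \<in> J\<^sub>0" for U V
      using that cls[of _ \<beta>] unfolding J\<^sub>0_def minimal_op_def op_closure_def by blast
    ultimately show ?thesis using XY by (metis subrelI)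
  next
    case False
    then obtain f where f: "f \<in> D\<^sub>A" "f \<noteq> 0" by blast
    \<comment> \<open>Almost everywhere \<open>A\<^sub>r t f - C f\<close> is the drift of \<open>\<alpha>\<close> times \<open>f\<close>, so the continuous function \<open>g\<close>
      agrees with the drift, and \<open>\<alpha>\<close> has no zeros inside the interval.\<close>
    define g where "g t = inner (op_apply (A\<^sub>r t) f - op_apply C f) f / (norm f)\<^sup>2" for t
    have "continuous_on {0..1} g"
      unfolding g_def using f by (intro continuous_intros C1_cont assms(15)) auto
    moreover have "AE t in unit_lebesgue. log_drift \<alpha> t = g t"
      using drift by eventually_elim (use f in \<open>simp add: g_def power2_norm_eq_inner\<close>)
    ultimately have \<alpha>_pos: "0 < \<alpha> t" if "t \<in> {0<..<1}" for t
      using continuous_log_drift_imp_pos[OF C2(1) _ _ _ that] w(1) by (simp add: weight_def)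
    show ?thesis
    proof (rule subrelI)
      fix U V assume UV: "(U, V) \<in> J\<^sub>0"
      then have carrier: "U \<in> hcarrier (weighted_L2 \<beta>)" "V \<in> hcarrier (weighted_L2 \<beta>)"
        unfolding J\<^sub>0_def minimal_op_def op_closure_def by blast+
      have "(weight_map \<beta> \<alpha> U, weight_map \<beta> \<alpha> V) \<in> minimal_op \<alpha> D\<^sub>A A"
        using minimal_op_transport[OF C2 w \<alpha>_pos \<beta>_nonneg A_lin A_dom A_cont B UV[unfolded J\<^sub>0_def]] .
      then have "(U, weight_map \<alpha> \<beta> (weight_map \<beta> \<alpha> V)) \<in> Jt"
        using Lt(2) carrier(1) unfolding Jt_def transported_op_def by blast
      then show "(U, V) \<in> Jt" by (simp add: weight_map_inverse[OF w(2,1) carrier(2)])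
    qed
  qed
  then have "op_extension (weighted_L2 \<beta>) J\<^sub>0 Jt"
    using F.linear_op_image[OF Lt(1)] by (simp add: op_extension_def Jt)
  then show ?thesis
    by (simp add: Jt F.normal_op_image_iff[OF sub] F.op_spectrum_image[OF sub])
qed

end
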